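(* Let $W$ be a finite Coxeter group of rank $n$ with base (set of fundamental roots) $\Pi$. Then for all $K \subseteq \Pi$, $$|\lambda(K)| = (-1)^{n-|K|}\, \frac{|W_K|}{|N_W(W_K)|}\, \chi(L^{\mathrm{Fix}(W_K)},-1).$$
   Context: $W$ is a finite Coxeter group of rank $n$ acting as a reflection group on a real Euclidean space $V$ of dimension $n$ (its standard reflection representation), with $W$-invariant root system and a base $\Pi$ of fundamental (simple) roots, $|\Pi|=n$. For $K \subseteq \Pi$, $W_K$ denotes the standard parabolic subgroup of $W$ generated by the reflections in the roots of $K$ (with $W_\emptyset$ trivial), $N_W(W_K)$ is its normalizer in $W$, and $\mathrm{Fix}(W_K)=\{v \in V : w(v)=v \text{ for all } w \in W_K\}$. For $J,K \subseteq \Pi$ write $J \sim K$ if $J = w(K)$ (as sets of roots) for some $w \in W$. Let $\lambda(K) = \{J \subseteq \Pi : J \sim K\}$ denote the equivalence class of $K$. Let $\mathcal{A}$ be the set of root hyperplanes of $W$ in $V$ (the hyperplanes orthogonal to the roots), and let $L$ be the set of all intersections of hyperplanes in $\mathcal{A}$, including $V$ itself (the empty intersection). Partially order $L$ by reverse inclusion, so $X \leq Y$ iff $X \supseteq Y$. The Moebius function $\mu$ of $L$ is defined by $\mu(X,X)=1$, $\sum_{X \leq Z \leq Y} \mu(Z,Y)=0$ if $X<Y$, and $\mu(X,Y)=0$ otherwise. The characteristic polynomial of $L$ is $\chi(L,t)=\sum_{X \in L}\mu(V,X)\,t^{\dim X}$. For $X \in L$, $L^X$ denotes the segment $\{Y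 \in L : Y \geq X\}$, with minimal element $X$, and its characteristic polynomial is $\chi(L^X,t)=\sum_{Y \in L,\, Y \geq X}\mu(X,Y)\,t^{\dim Y}$. *)

theory Defs
  imports
    "HOL-Analysis.Analysis"
    "HOL-Algebra.Generated_Groups"
    "HOL-Algebra.Group_Action"
    "HOL-Computational_Algebra.Polynomial"
begin

text \<open>
  The Euclidean space \<open>V\<close> is the whole type \<open>'a\<close> of class \<^class>\<open>real_inner\<close>. This class does not
  demand finite dimension, but a finite spanning root system forces it. Unlike
  \<^class>\<open>euclidean_space\<close>, it admits the zero space, i.e. rank \<open>0\<close>.
\<close>

definition reflection :: "'a::real_inner \<Rightarrow> 'a \<Rightarrow> 'a" where
  "reflection \<alpha> v = v - (2 * inner v \<alpha> / inner \<alpha> \<alpha>) *\<^sub>R \<alpha>"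

text \<open>
  Root systems are reduced but need be neither crystallographic nor normalised to unit vectors.
\<close>

definition root_system :: "'a::real_inner set \<Rightarrow> bool" where
  "root_system \<Phi> \<longleftrightarrow> finite \<Phi> \<and> 0 \<notin> \<Phi> \<and>
     (\<forall>\<alpha>\<in>\<Phi>. reflection \<alpha> ` \<Phi> = \<Phi>) \<and>
     (\<forall>\<alpha>\<in>\<Phi>. \<Phi> \<inter> range (\<lambda>c. c *\<^sub>R \<alpha>) = {\<alpha>, - \<alpha>})"

definition root_base :: "'a::real_inner set \<Rightarrow> 'a set \<Rightarrow> bool" where
  "root_base \<Phi> \<Delta> \<longleftrightarrow> \<Delta> \<subseteq> \<Phi> \<and> independent \<Delta> \<and>
     (\<forall>\<alpha>\<in>\<Phi>. \<exists>c. \<alpha> = (\<Sum>\<beta>\<in>\<Delta>. c \<beta> *\<^sub>R \<beta>) \<and>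
        ((\<forall>\<beta>\<in>\<Delta>. 0 \<le> c \<beta>) \<or> (\<forall>\<beta>\<in>\<Delta>. c \<beta> \<le> 0)))"

text \<open>
  For a root system \<open>\<Phi>\<close> with base \<open>\<Delta>\<close>, the group \<open>W\<close> is \<open>reflection_group \<Phi>\<close> and the standard
  parabolic subgroup \<open>W\<^sub>K\<close>, for \<open>K \<subseteq> \<Delta>\<close>, is \<open>reflection_group K\<close>.
\<close>

definition reflection_group :: "'a::real_inner set \<Rightarrow> ('a \<Rightarrow> 'a) monoid" where
  "reflection_group S = subgroup_generated (BijGroup UNIV) (reflection ` S)"

text \<open>
  \<^const>\<open>subgroup_generated\<close> silently discards generators outside the carrier; the following lemma
  shows that none is lost.
\<close>

lemma reflection_in_Bij: "reflection \<alpha> \<in> carrier (BijGroup UNIV)"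
proof -
  have "reflection \<alpha> (reflection \<alpha> v) = v" for v
    by (cases "\<alpha> = 0")
      (simp_all add: reflection_def inner_diff_left scaleR_left_distrib[symmetric] field_simps)
  then have "bij (reflection \<alpha>)"
    by (rule involuntory_imp_bij)
  then show ?thesis
    by (simp add: BijGroup_def Bij_def)
qed

definition fixed_space :: "('a \<Rightarrow> 'a) monoid \<Rightarrow> 'a set" where
  "fixed_space G = {v. \<forall>w\<in>carrier G. w v = v}"

definition similar :: "'a::real_inner set \<Rightarrow> 'a set \<Rightarrow> 'a set \<Rightarrow> bool" where
  "similar \<Phi> J K \<longleftrightarrow> (\<exists>w\<in>carrier (reflection_group \<Phi>). J = w ` K)"

definition similarity_class :: "'a::real_inner set \<Rightarrow> 'a set \<Rightarrow> 'a set \<Rightarrow> 'a set set" where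
  "similarity_class \<Phi> \<Delta> K = {J. J \<subseteq> \<Delta> \<and> similar \<Phi> J K}"

definition root_hyperplanes :: "'a::real_inner set \<Rightarrow> 'a set set" where
  "root_hyperplanes \<Phi> = (\<lambda>\<alpha>. {v. inner \<alpha> v = 0}) ` \<Phi>"

text \<open>The subfamily \<open>{}\<close> contributes \<open>\<Inter>{} = UNIV\<close>, the whole space.\<close>

definition intersection_lattice :: "'a::real_inner set \<Rightarrow> 'a set set" where
  "intersection_lattice \<Phi> = {\<Inter>\<B> |\<B>. \<B> \<subseteq> root_hyperplanes \<Phi>}"

text \<open>
  The Moebius function of a finite family \<open>L\<close> of sets ordered by reverse inclusion, so that
  \<open>X \<le> Y\<close> in \<open>L\<close> means \<open>Y \<subseteq> X\<close>. The recursion solves \<open>\<Sum>\<^bsub>X \<le> Z \<le> Y\<^esub> \<mu>(Z, Y) = 0\<close> for \<open>\<mu>(X, Y)\<close>; the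
  finiteness test only serves termination.
\<close>

function moebius :: "'b set set \<Rightarrow> 'b set \<Rightarrow> 'b set \<Rightarrow> int" where
  "moebius L X Y =
     (if finite L \<and> X \<in> L \<and> Y \<in> L \<and> Y \<subseteq> X
      then if X = Y then 1 else - (\<Sum>Z\<in>{Z \<in> L. Y \<subseteq> Z \<and> Z \<subset> X}. moebius L Z Y)
      else 0)"
  by pat_completeness auto
termination
  by (relation "Wellfounded.measure (\<lambda>(L, X, Y). card {Z \<in> L. Z \<subset> X})")
    (auto intro!: psubset_card_mono)

declare moebius.simps [simp del]

lemma moebius_refl: "finite L \<Longrightarrow> X \<in> L \<Longrightarrow> moebius L X X = 1"
  by (simp add: moebius.simps)

lemma moebius_sum:
  assumes "finite L" "X \<in> L" "Y \<in> L" "Y \<subset> X"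
  shows "(\<Sum>Z\<in>{Z \<in> L. Y \<subseteq> Z \<and> Z \<subseteq> X}. moebius L Z Y) = 0"
proof -
  have "{Z \<in> L. Y \<subseteq> Z \<and> Z \<subseteq> X} = insert X {Z \<in> L. Y \<subseteq> Z \<and> Z \<subset> X}"
    using assms by auto
  then show ?thesis
    using assms by (simp add: moebius.simps[of L X Y])
qed

lemma moebius_eq_0: "\<not> Y \<subseteq> X \<Longrightarrow> moebius L X Y = 0"
  by (simp add: moebius.simps)

text \<open>
  The characteristic polynomial \<open>\<chi>(L\<^sup>X, t)\<close> of the segment \<open>L\<^sup>X = {Y \<in> L. Y \<ge> X}\<close>; the case
  \<open>X = UNIV\<close> is \<open>\<chi>(L, t)\<close>.
\<close>

definition upper_segment :: "'a set set \<Rightarrow> 'a set \<Rightarrow> 'a set set" where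
  "upper_segment L X = {Y \<in> L. Y \<subseteq> X}"

definition segment_char_poly :: "'a::real_vector set set \<Rightarrow> 'a set \<Rightarrow> int poly" where
  "segment_char_poly L X = (\<Sum>Y\<in>upper_segment L X. monom (moebius L X Y) (dim Y))"

end

theory Submission
  imports Defs
begin

text \<open>
  Write \<open>X = Fix(W\<^sub>K)\<close>. Both sides count the faces of the Coxeter arrangement with linear span \<open>X\<close>,
  that is, the chambers of the restriction of the arrangement to \<open>X\<close>.

  For every \<open>X \<in> L\<close> the Euler relation \<open>\<Sum>\<^sub>F (-1)^dim F = (-1)^dim X\<close> holds over the faces \<open>F \<subseteq> X\<close>.
  Grouping the faces by their span and applying Moebius inversion yields
  Zaslavsky's formula \<open>(-1)^dim X \<chi>(L\<^sup>X, -1)\<close> for the number of faces with span \<open>X\<close>.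

  On the other hand, every face is \<open>w C\<^sub>J\<close> for a unique standard face \<open>C\<^sub>J\<close> (\<open>J \<subseteq> \<Pi>\<close>) and a unique coset
  \<open>w W\<^sub>J\<close>, and it spans \<open>X\<close> iff \<open>w\<close> maps \<open>Fix(W\<^sub>J)\<close> onto \<open>X\<close>. Such a \<open>w\<close> exists iff \<open>J \<sim> K\<close>, and then these \<open>w\<close>
  form one coset of \<open>N\<^sub>W(W\<^sub>K)\<close>. Counting the pairs \<open>(J, w)\<close> in two ways shows that
  \<open>|\<lambda>(K)| |N\<^sub>W(W\<^sub>K)|\<close> is \<open>|W\<^sub>K|\<close> times the number of faces with span \<open>X\<close>.
\<close>

subsection \<open>Orthogonal complements\<close>

text \<open>For a set of roots this is the flat cut out by their hyperplanes, so \<open>perp\<close>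
  parametrises the intersection lattice by subsets of roots.\<close>

definition perp :: "'a::real_inner set \<Rightarrow> 'a set" where
  "perp A = {v. \<forall>a\<in>A. inner a v = 0}"

lemma subspace_perp: "subspace (perp A)"
  by (auto simp: perp_def subspace_def inner_add_right)

lemma perp_mono: "A \<subseteq> B \<Longrightarrow> perp B \<subseteq> perp A"
  by (auto simp: perp_def)

text \<open>Subtracting a multiple of \<open>u\<close> moves any vector of \<open>S\<close> into the
  slice, so a basis of the slice together with \<open>u\<close> is a basis of \<open>S\<close>. The
  finite spanning set \<open>T\<close> makes these bases finite.\<close>

lemma dim_slice:
  fixes a u :: "'a::real_inner"
  assumes "finite T" "span T = (UNIV :: 'a set)"
    and S: "subspace S" and u: "u \<in> S" "inner a u \<noteq> 0"
  shows "dim S = Suc (dim {v \<in> S. inner a v = 0})"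
proof -
  let ?H = "{v \<in> S. inner a v = 0}"
  have H: "subspace ?H"
    using S by (auto simp: subspace_def inner_add_right)
  obtain B where B: "B \<subseteq> ?H" "independent B" "?H \<subseteq> span B" "card B = dim ?H"
    by (rule basis_exists)
  have finB: "finite B"
    using independent_span_bound[OF assms(1) B(2)] assms(2) by auto
  have spanB: "span B = ?H"
    using span_minimal[OF B(1) H] B(3) by (rule equalityI)
  have uB: "u \<notin> span B"
    using spanB u by auto
  have "S \<subseteq> span (insert u B)"
  proof
    fix v assume v: "v \<in> S"
    let ?t = "inner a v / inner a u"
    have "v - ?t *\<^sub>R u \<in> ?H"
      using v u S by (auto simp: inner_diff_right intro!: subspace_diff subspace_scale)
    then have "v - ?t *\<^sub>R u \<in> span B"
      by (simp add: spanB)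
    then show "v \<in> span (insert u B)"
      by (auto simp: span_insert)
  qed
  moreover have "insert u B \<subseteq> S"
    using B u by auto
  moreover have "independent (insert u B)"
    using B uB by (simp add: independent_insertI)
  ultimately have "dim S = card (insert u B)"
    by (intro dim_unique) auto
  also have "\<dots> = Suc (dim ?H)"
    using finB uB B by (metis card_insert_disjoint span_base)
  finally show ?thesis .
qed

lemma perp_insert: "perp (insert a A) = {v \<in> perp A. inner a v = 0}"
  by (auto simp: perp_def)

subsection \<open>Cells of a central arrangement\<close>

text \<open>The face of the arrangement through \<open>v\<close>, given by its sign vector. All
  faces together form \<open>range (cell A)\<close>.\<close>

definition cell :: "'a::real_inner set \<Rightarrow> 'a \<Rightarrow> 'a set" where
  "cell A v = {u. \<forall>a\<in>A. sgn (inner a u) = sgn (inner a v)}"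

lemma mem_cell_self [simp]: "v \<in> cell A v"
  by (simp add: cell_def)

lemma cell_eq: "u \<in> cell A v \<Longrightarrow> cell A u = cell A v"
  by (simp add: cell_def)

lemma cell_zero: "u \<in> cell A v \<Longrightarrow> a \<in> A \<Longrightarrow> inner a u = 0 \<longleftrightarrow> inner a v = 0"
proof -
  assume "u \<in> cell A v" "a \<in> A"
  then have "sgn (inner a u) = sgn (inner a v)"
    unfolding cell_def by blast
  then show ?thesis
    by (metis sgn_zero_iff)
qed

lemma cell_insert: "cell (insert a A) v = {u \<in> cell A v. sgn (inner a u) = sgn (inner a v)}"
  by (auto simp: cell_def)

text \<open>A further hyperplane splits a cell into at most three pieces, one per sign.\<close>

lemma finite_range_cell:
  assumes "finite A"
  shows "finite (range (cell A))"
  using assms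
proof (induction A rule: finite_induct)
  case empty
  then show ?case by (simp add: cell_def)
next
  case (insert a A)
  have "range (cell (insert a A)) \<subseteq>
      (\<lambda>(F, s). {u \<in> F. sgn (inner a u) = s}) ` (range (cell A) \<times> {-1, 0, 1 :: real})"
  proof (rule image_subsetI)
    fix v
    have "sgn (inner a v) \<in> {-1, 0, 1}"
      by (simp add: sgn_real_def)
    then show "cell (insert a A) v \<in>
        (\<lambda>(F, s). {u \<in> F. sgn (inner a u) = s}) ` (range (cell A) \<times> {-1, 0, 1 :: real})"
      by (intro image_eqI[of _ _ "(cell A v, sgn (inner a v))"]) (simp_all add: cell_insert)
  qed
  then show ?case
    by (rule finite_subset) (use insert in simp)
qed

text \<open>Nonzero signs survive small moves by continuity, and moving along \<open>u\<close> does
  not change the inner products that vanish at \<open>v\<close>.\<close>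

lemma cell_perturb:
  fixes u v :: "'a::real_inner"
  assumes "finite A" and u: "u \<in> perp {a \<in> A. inner a v = 0}"
  obtains e where "e > 0" "v + e *\<^sub>R u \<in> cell A v" "v - e *\<^sub>R u \<in> cell A v"
proof -
  have "\<forall>a\<in>A. eventually (\<lambda>t. sgn (inner a (v + t *\<^sub>R u)) = sgn (inner a v)) (at 0)"
  proof
    fix a assume a: "a \<in> A"
    have lim: "((\<lambda>t. inner a (v + t *\<^sub>R u)) \<longlongrightarrow> inner a v) (at 0)"
    proof -
      have "((\<lambda>t. inner a (v + t *\<^sub>R u)) \<longlongrightarrow> inner a (v + 0 *\<^sub>R u)) (at 0)"
        by (intro tendsto_intros)
      then show ?thesis by simp
    qed
    consider "inner a v = 0" | "inner a v > 0" | "inner a v < 0"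
      by linarith
    then show "eventually (\<lambda>t. sgn (inner a (v + t *\<^sub>R u)) = sgn (inner a v)) (at 0)"
    proof cases
      case 1
      then have "inner a u = 0"
        using u a by (simp add: perp_def)
      then show ?thesis
        by (simp add: inner_add_right)
    next
      case 2
      show ?thesis
        using order_tendstoD(1)[OF lim 2] by eventually_elim (use 2 in simp)
    next
      case 3
      show ?thesis
        using order_tendstoD(2)[OF lim 3] by eventually_elim (use 3 in simp)
    qed
  qed
  then have "eventually (\<lambda>t. \<forall>a\<in>A. sgn (inner a (v + t *\<^sub>R u)) = sgn (inner a v)) (at 0)"
    using assms(1) by (simp add: eventually_ball_finite)
  then have "eventually (\<lambda>t. v + t *\<^sub>R u \<in> cell A v) (at 0)"
    by (simp add: cell_def)
  then obtain d where d: "d > 0" "\<And>t. t \<noteq> 0 \<Longrightarrow> \<bar>t\<bar> < d \<Longrightarrow> v + t *\<^sub>R u \<in> cell A v"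
    by (auto simp: eventually_at dist_real_def)
  have "v - (d/2) *\<^sub>R u \<in> cell A v"
    using d(2)[of "- (d/2)"] d(1) by simp
  moreover have "v + (d/2) *\<^sub>R u \<in> cell A v"
    using d(2)[of "d/2"] d(1) by simp
  ultimately show thesis
    using that[of "d/2"] d(1) by simp
qed

text \<open>A cell is relatively open in the flat defined by its vanishing inner products, so
  differences of its points reach every direction of that flat.\<close>

lemma span_cell:
  assumes "finite A"
  shows "span (cell A v) = perp {a \<in> A. inner a v = 0}"
proof
  show "span (cell A v) \<subseteq> perp {a \<in> A. inner a v = 0}"
  proof (rule span_minimal)
    show "cell A v \<subseteq> perp {a \<in> A. inner a v = 0}"
      by (auto simp: perp_def cell_zero)
  qed (rule subspace_perp)
next
  show "perp {a \<in> A. inner a v = 0} \<subseteq> span (cell A v)"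
  proof
    fix u assume "u \<in> perp {a \<in> A. inner a v = 0}"
    then obtain e where e: "e > 0" "v + e *\<^sub>R u \<in> cell A v"
      using cell_perturb[OF assms] by metis
    have "u = (1/e) *\<^sub>R ((v + e *\<^sub>R u) - v)"
      using e by simp
    then show "u \<in> span (cell A v)"
      using e by (metis mem_cell_self span_base span_diff span_scale)
  qed
qed

lemma cell_convex_cone:
  assumes "u \<in> cell A v" "w \<in> cell A v" "s > 0" "t > 0"
  shows "s *\<^sub>R u + t *\<^sub>R w \<in> cell A v"
proof -
  have "sgn (s * x + t * y) = c" if "sgn x = c" "sgn y = c" for x y c :: real
  proof (cases x "0::real" rule: linorder_cases)
    case less
    then have "c = -1" "y < 0"
      using that by (auto simp: sgn_real_def split: if_splits)
    then have "s * x + t * y < 0"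
      using less assms(3,4) by (simp add: add_neg_neg mult_pos_neg)
    then show ?thesis
      using \<open>c = -1\<close> by simp
  next
    case equal
    then show ?thesis
      using that by (simp add: sgn_zero_iff)
  next
    case greater
    then have "c = 1" "y > 0"
      using that by (auto simp: sgn_real_def split: if_splits)
    then have "s * x + t * y > 0"
      using greater assms(3,4) by (simp add: add_pos_pos)
    then show ?thesis
      using \<open>c = 1\<close> by simp
  qed
  then show ?thesis
    using assms(1,2) by (simp add: cell_def inner_add_right)
qed

text \<open>Convexity provides a point of the cell on the hyperplane of \<open>a\<close>; relative
  openness then provides points on both sides of it.\<close>

lemma cell_three_signs:
  assumes A: "finite A" and u: "u \<in> cell A v" "w \<in> cell A v" "sgn (inner a u) \<noteq> sgn (inner a w)"
  obtains p m z where "p \<in> cell A v" "m \<in> cell A v" "z \<in> cell A v"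
    "inner a p > 0" "inner a m < 0" "inner a z = 0"
proof -
  note result = that
  have key: thesis if z: "z \<in> cell A v" "inner a z = 0" and y: "y \<in> cell A v" "inner a y \<noteq> 0" for z y
  proof -
    \<comment> \<open>Since \<open>y\<close> lies in the flat of the cell, one can move from
      \<open>z\<close> along both \<open>y\<close> and \<open>-y\<close>; as
      \<open>inner a y\<close> is nonzero, this leads to opposite sides.\<close>
    have "y \<in> perp {b \<in> A. inner b z = 0}"
      using z y span_cell[OF A, of v] cell_eq[OF z(1)] span_cell[OF A, of z] by (metis span_base)
    then obtain e where e: "e > 0" "z + e *\<^sub>R y \<in> cell A v" "z - e *\<^sub>R y \<in> cell A v"
      using cell_perturb[OF A] cell_eq[OF z(1)] by metis
    show thesis
    proof (cases "inner a y > 0")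
      case True
      show thesis
        by (rule result[OF e(2,3) z(1)]) (use e z True in \<open>auto simp: inner_add_right inner_diff_right\<close>)
    next
      case False
      show thesis
        by (rule result[OF e(3,2) z(1)])
          (use e z y False in \<open>auto simp: inner_add_right inner_diff_right mult_pos_neg\<close>)
    qed
  qed
  show thesis
  proof (cases "inner a u = 0 \<or> inner a w = 0")
    case True
    then show thesis
      using key u by metis
  next
    case False
    \<comment> \<open>Here \<open>u\<close> and \<open>w\<close> lie strictly on opposite sides; the
      weights make their contributions to \<open>inner a ?z\<close> cancel.\<close>
    let ?z = "\<bar>inner a w\<bar> *\<^sub>R u + \<bar>inner a u\<bar> *\<^sub>R w"
    have "?z \<in> cell A v"
      using u False by (intro cell_convex_cone) auto
    moreover have "inner a ?z = 0"
      using u(3) False by (auto simp: inner_add_right sgn_real_def abs_real_def split: if_splits)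
    ultimately show thesis
      using key u False by metis
  qed
qed

text \<open>Either \<open>a\<close> has constant sign on the cell and nothing is split, or
  \<open>p\<close>, \<open>m\<close> and \<open>z\<close> represent the three pieces. The open
  pieces keep the span of the cell, while the piece of \<open>z\<close> spans a proper slice of it,
  as \<open>p\<close> shows.\<close>

lemma euler_subdivide_cell:
  fixes a v :: "'a::real_inner"
  assumes "finite T" "span T = (UNIV :: 'a set)" and A: "finite A"
  shows "(\<Sum>G\<in>cell (insert a A) ` cell A v. (-1::int) ^ dim G) = (-1) ^ dim (cell A v)"
proof (cases "\<exists>c. \<forall>u\<in>cell A v. sgn (inner a u) = c")
  case True
  then obtain c where "\<And>u. u \<in> cell A v \<Longrightarrow> sgn (inner a u) = c"
    by auto
  then have "cell (insert a A) u = cell A v" if "u \<in> cell A v" for u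
    using that by (auto simp: cell_insert cell_eq[OF that])
  then have "cell (insert a A) ` cell A v = (\<lambda>_. cell A v) ` cell A v"
    by (rule image_cong[OF refl])
  also have "\<dots> = {cell A v}"
    using mem_cell_self by (rule image_constant)
  finally show ?thesis by simp
next
  case False
  then obtain u where "u \<in> cell A v" "sgn (inner a u) \<noteq> sgn (inner a v)"
    by blast
  then obtain p m z where pmz: "p \<in> cell A v" "m \<in> cell A v" "z \<in> cell A v"
    "inner a p > 0" "inner a m < 0" "inner a z = 0"
    using cell_three_signs[OF A, of u v v a] mem_cell_self by metis
  let ?c = "cell (insert a A)"
  have flat: "perp {b \<in> A. inner b x = 0} = span (cell A v)" if "x \<in> cell A v" for x
    using that span_cell[OF A, of x] cell_eq[OF that] by simp
  have dim_eq: "dim (?c x) = dim (cell A v)" if "x \<in> cell A v" "inner a x \<noteq> 0" for x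
  proof -
    have "{b \<in> insert a A. inner b x = 0} = {b \<in> A. inner b x = 0}"
      using that by auto
    then have "span (?c x) = span (cell A v)"
      using span_cell[of "insert a A" x] A flat[OF that(1)] by simp
    then show ?thesis by (metis dim_span)
  qed
  have "{b \<in> insert a A. inner b z = 0} = insert a {b \<in> A. inner b z = 0}"
    using pmz by auto
  then have "span (?c z) = {x \<in> span (cell A v). inner a x = 0}"
    using span_cell[of "insert a A" z] A flat[OF pmz(3)] by (simp add: perp_insert)
  then have dim_z: "dim (cell A v) = Suc (dim (?c z))"
    using dim_slice[OF assms(1,2), of "span (cell A v)" p a] pmz
    by (metis dim_span less_irrefl span_base subspace_span)
  have "?c ` cell A v = {?c p, ?c m, ?c z}"
  proof -
    have "?c x \<in> {?c p, ?c m, ?c z}" if x: "x \<in> cell A v" for x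
    proof -
      have c: "?c x = ?c y" if "sgn (inner a x) = sgn (inner a y)" "y \<in> cell A v" for y
        using that cell_eq[OF x] cell_eq[OF that(2)] by (simp add: cell_insert)
      show ?thesis
        using c[of p] c[of m] c[of z] pmz
        by (cases "inner a x" "0::real" rule: linorder_cases) simp_all
    qed
    then show ?thesis
      using pmz(1-3) by (intro equalityI image_subsetI) auto
  qed
  moreover have "?c p \<noteq> ?c m" "?c p \<noteq> ?c z" "?c m \<noteq> ?c z"
  proof -
    have "sgn (inner a x) = sgn (inner a y)" if "?c x = ?c y" for x y
      using that mem_cell_self[of x "insert a A"] by (simp add: cell_def)
    from this[of p m] this[of p z] this[of m z] pmz(4-6)
    show "?c p \<noteq> ?c m" "?c p \<noteq> ?c z" "?c m \<noteq> ?c z"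
      by auto
  qed
  ultimately show ?thesis
    using pmz dim_eq[of p] dim_eq[of m] dim_z by simp
qed

text \<open>
  Hyperplanes are added one at a time: a new one leaves a cell alone or cuts it into two cells of
  the same dimension and one of dimension one less, and \<open>1 + 1 - 1 = 1\<close>.
\<close>

lemma euler_cells:
  fixes B :: "'a::real_inner set"
  assumes T: "finite T" "span T = (UNIV :: 'a set)" and "finite D" "finite B"
  shows "(\<Sum>F\<in>cell (D \<union> B) ` perp B. (-1::int) ^ dim F) = (-1) ^ dim (perp B)"
  using assms(3)
proof (induction D rule: finite_induct)
  case empty
  \<comment> \<open>All signs for \<open>B\<close> are zero on \<open>perp B\<close>, so before any
    member of \<open>D\<close> is added the flat is a single cell.\<close>
  have "cell B v = perp B" if "v \<in> perp B" for v
    using that by (auto simp: cell_def perp_def sgn_0_0)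
  then have "cell B ` perp B = (\<lambda>_. perp B) ` perp B"
    by (rule image_cong[OF refl])
  also have "\<dots> = {perp B}"
    using subspace_0[OF subspace_perp] by (rule image_constant)
  finally show ?case by simp
next
  case (insert a D)
  let ?A = "D \<union> B"
  have fin: "finite ?A" "finite (insert a ?A)"
    using insert assms by auto
  have sub: "cell ?A v \<subseteq> perp B" if "v \<in> perp B" for v
  proof
    fix u assume u: "u \<in> cell ?A v"
    have "inner b u = 0" if "b \<in> B" for b
      using cell_zero[OF u, of b] that \<open>v \<in> perp B\<close> by (simp add: perp_def)
    then show "u \<in> perp B"
      by (simp add: perp_def)
  qed
  have split: "cell (insert a ?A) ` perp B =
      (\<Union>F\<in>cell ?A ` perp B. cell (insert a ?A) ` F)"
  proof
    show "cell (insert a ?A) ` perp B \<subseteq> (\<Union>F\<in>cell ?A ` perp B. cell (insert a ?A) ` F)"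
    proof (rule image_subsetI)
      fix v assume "v \<in> perp B"
      then show "cell (insert a ?A) v \<in> (\<Union>F\<in>cell ?A ` perp B. cell (insert a ?A) ` F)"
        by (intro UN_I[of "cell ?A v"] imageI mem_cell_self)
    qed
  next
    show "(\<Union>F\<in>cell ?A ` perp B. cell (insert a ?A) ` F) \<subseteq> cell (insert a ?A) ` perp B"
      using sub by auto
  qed
  have finite_im: "finite (cell A ` S)" if "finite A" for A S :: "'a set"
    using finite_range_cell[OF that] by (rule finite_subset[rotated]) auto
  have disj: "cell (insert a ?A) ` F \<inter> cell (insert a ?A) ` G = {}"
    if "F \<in> cell ?A ` perp B" "G \<in> cell ?A ` perp B" "F \<noteq> G" for F G
  proof (rule ccontr)
    assume "cell (insert a ?A) ` F \<inter> cell (insert a ?A) ` G \<noteq> {}"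
    then obtain x y where "x \<in> F" "y \<in> G" "cell (insert a ?A) x = cell (insert a ?A) y"
      by auto
    then have "x \<in> cell ?A y"
      using mem_cell_self[of x "insert a ?A"] by (auto simp: cell_insert)
    with \<open>x \<in> F\<close> \<open>y \<in> G\<close> that show False
      by (metis cell_eq imageE)
  qed
  have "(\<Sum>F\<in>cell (insert a ?A) ` perp B. (-1::int) ^ dim F) =
      (\<Sum>F\<in>cell ?A ` perp B. \<Sum>G\<in>cell (insert a ?A) ` F. (-1) ^ dim G)"
    unfolding split by (rule sum.UNION_disjoint) (use fin finite_im disj in auto)
  also have "\<dots> = (\<Sum>F\<in>cell ?A ` perp B. (-1) ^ dim F)"
    using euler_subdivide_cell[OF T fin(1), of a] by (intro sum.cong) auto
  finally show ?case
    using insert by simp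
qed

subsection \<open>Moebius inversion\<close>

text \<open>The recursion of \<open>moebius\<close> runs over its first argument, hence the
  induction on the number of members of \<open>L\<close> strictly inside \<open>X\<close>. Inserting
  the recursion and exchanging the two sums leaves minus the sum of \<open>f Z\<close> over
  \<open>Z\<close> strictly inside \<open>X\<close>.\<close>

lemma moebius_inversion:
  fixes f g :: "'b set \<Rightarrow> int"
  assumes L: "finite L" and "X \<in> L"
    and fg: "\<And>X. X \<in> L \<Longrightarrow> (\<Sum>Y\<in>{Y \<in> L. Y \<subseteq> X}. f Y) = g X"
  shows "f X = (\<Sum>Y\<in>{Y \<in> L. Y \<subseteq> X}. moebius L X Y * g Y)"
  using assms(2)
proof (induction "card {Z \<in> L. Z \<subset> X}" arbitrary: X rule: less_induct)
  case less
  have split: "{Y \<in> L. Y \<subseteq> X} = insert X {Y \<in> L. Y \<subset> X}"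
    using less.prems by auto
  have IH: "f Z = (\<Sum>Y\<in>{Y \<in> L. Y \<subseteq> Z}. moebius L Z Y * g Y)" if "Z \<in> L" "Z \<subset> X" for Z
  proof (rule less.hyps[OF _ that(1)])
    show "card {U \<in> L. U \<subset> Z} < card {U \<in> L. U \<subset> X}"
      using L that by (intro psubset_card_mono) auto
  qed
  \<comment> \<open>The conditional makes the range of \<open>Z\<close> independent of
    \<open>Y\<close>, which allows the double sum to be exchanged.\<close>
  have rec: "moebius L X Y = - (\<Sum>Z\<in>{Z \<in> L. Z \<subset> X}. if Y \<subseteq> Z then moebius L Z Y else 0)"
    if "Y \<in> L" "Y \<subset> X" for Y
  proof -
    have "moebius L X Y = - (\<Sum>Z\<in>{Z \<in> L. Y \<subseteq> Z \<and> Z \<subset> X}. moebius L Z Y)"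
      using that less.prems L by (auto simp: moebius.simps[of L X Y])
    also have "(\<Sum>Z\<in>{Z \<in> L. Y \<subseteq> Z \<and> Z \<subset> X}. moebius L Z Y) =
        (\<Sum>Z\<in>{Z \<in> L. Z \<subset> X}. if Y \<subseteq> Z then moebius L Z Y else 0)"
      using L by (intro sum.mono_neutral_cong_left) auto
    finally show ?thesis .
  qed
  have "(\<Sum>Y\<in>{Y \<in> L. Y \<subset> X}. moebius L X Y * g Y) =
      (\<Sum>Y\<in>{Y \<in> L. Y \<subset> X}. \<Sum>Z\<in>{Z \<in> L. Z \<subset> X}. - (if Y \<subseteq> Z then moebius L Z Y * g Y else 0))"
  proof (rule sum.cong[OF refl])
    fix Y assume "Y \<in> {Y \<in> L. Y \<subset> X}"
    then show "moebius L X Y * g Y =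
        (\<Sum>Z\<in>{Z \<in> L. Z \<subset> X}. - (if Y \<subseteq> Z then moebius L Z Y * g Y else 0))"
      unfolding sum_negf
      by (simp add: rec sum_distrib_right if_distrib[of "\<lambda>x. x * g Y"] del: sum.inter_filter
          cong: if_cong)
  qed
  also have "\<dots> = - (\<Sum>Z\<in>{Z \<in> L. Z \<subset> X}. \<Sum>Y\<in>{Y \<in> L. Y \<subset> X}. if Y \<subseteq> Z then moebius L Z Y * g Y else 0)"
    by (subst sum.swap) (simp add: sum_negf)
  also have "(\<Sum>Z\<in>{Z \<in> L. Z \<subset> X}. \<Sum>Y\<in>{Y \<in> L. Y \<subset> X}. if Y \<subseteq> Z then moebius L Z Y * g Y else 0) =
      (\<Sum>Z\<in>{Z \<in> L. Z \<subset> X}. f Z)"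
  proof (intro sum.cong refl)
    fix Z assume Z: "Z \<in> {Z \<in> L. Z \<subset> X}"
    have "(\<Sum>Y\<in>{Y \<in> L. Y \<subset> X}. if Y \<subseteq> Z then moebius L Z Y * g Y else 0) =
        (\<Sum>Y\<in>{Y \<in> L. Y \<subseteq> Z}. moebius L Z Y * g Y)"
      using L Z by (intro sum.mono_neutral_cong_right) auto
    then show "(\<Sum>Y\<in>{Y \<in> L. Y \<subset> X}. if Y \<subseteq> Z then moebius L Z Y * g Y else 0) = f Z"
      using IH Z by simp
  qed
  finally have "(\<Sum>Y\<in>{Y \<in> L. Y \<subset> X}. moebius L X Y * g Y) = - (\<Sum>Z\<in>{Z \<in> L. Z \<subset> X}. f Z)" .
  moreover have "g X = f X + (\<Sum>Z\<in>{Z \<in> L. Z \<subset> X}. f Z)"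
    using fg[OF less.prems] L unfolding split by (simp add: less_le)
  ultimately show ?case
    using less.prems L unfolding split by (simp add: moebius_refl)
qed

section \<open>The intersection lattice and Zaslavsky's formula\<close>

lemma intersection_lattice_eq: "intersection_lattice A = perp ` Pow A"
proof -
  have "intersection_lattice A = (\<lambda>B. \<Inter> ((\<lambda>a. {v. inner a v = 0}) ` B)) ` Pow A"
    unfolding intersection_lattice_def root_hyperplanes_def by (auto elim!: subset_imageE)
  also have "\<dots> = perp ` Pow A"
    by (intro image_cong) (auto simp: perp_def)
  finally show ?thesis .
qed

lemma finite_intersection_lattice: "finite A \<Longrightarrow> finite (intersection_lattice A)"
  by (simp add: intersection_lattice_eq)

lemma minus_one_power_mult_cancel: "(-1::int) ^ n * ((-1) ^ n * x) = x"
  by (cases "even n") auto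

theorem zaslavsky:
  fixes A B :: "'a::real_inner set"
  assumes A: "finite A" "span A = UNIV" and B: "B \<subseteq> A"
  shows "int (card {F \<in> range (cell A). span F = perp B}) =
    (-1) ^ dim (perp B) * poly (segment_char_poly (intersection_lattice A) (perp B)) (-1)"
proof -
  let ?L = "intersection_lattice A"
  \<comment> \<open>Faces are counted by span, with their sign. With this weight the Euler relation
    is the summation hypothesis of Moebius inversion for \<open>g X = (-1) ^ dim X\<close>.\<close>
  define f where "f Y = (-1::int) ^ dim Y * int (card {F \<in> range (cell A). span F = Y})" for Y
  have L: "finite ?L"
    using A by (simp add: finite_intersection_lattice)
  have fin: "finite (range (cell A))"
    using A by (simp add: finite_range_cell)
  have sum_f: "(\<Sum>Y\<in>{Y \<in> ?L. Y \<subseteq> X}. f Y) = (-1) ^ dim X" if "X \<in> ?L" for X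
  proof -
    obtain C where C: "C \<subseteq> A" "X = perp C"
      using \<open>X \<in> ?L\<close> by (auto simp: intersection_lattice_eq)
    have cells: "cell A ` X = {F \<in> range (cell A). span F \<subseteq> X}"
    proof -
      have "span (cell A v) \<subseteq> X" if "v \<in> X" for v
        using that C span_cell[OF A(1), of v] by (auto simp: perp_def subset_iff)
      moreover have "v \<in> X" if "span (cell A v) \<subseteq> X" for v
        using that mem_cell_self[of v A] by (meson span_base subsetD)
      ultimately show ?thesis by auto
    qed
    have spanL: "span F \<in> ?L" if "F \<in> range (cell A)" for F
      using that span_cell[OF A(1)] by (auto simp: intersection_lattice_eq)
    have "(-1) ^ dim X = (\<Sum>F\<in>cell A ` X. (-1::int) ^ dim F)"
      using euler_cells[OF A(1,2), of A C] C A(1) by (simp add: Un_absorb2 finite_subset)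
    also have "\<dots> = (\<Sum>Y\<in>{Y \<in> ?L. Y \<subseteq> X}. \<Sum>F\<in>{F \<in> {F \<in> range (cell A). span F \<subseteq> X}. span F = Y}. (-1) ^ dim F)"
      unfolding cells by (rule sum.group[symmetric]) (use L fin spanL in auto)
    also have "\<dots> = (\<Sum>Y\<in>{Y \<in> ?L. Y \<subseteq> X}. f Y)"
    proof (intro sum.cong refl)
      fix Y assume "Y \<in> {Y \<in> ?L. Y \<subseteq> X}"
      then have "{F \<in> {F \<in> range (cell A). span F \<subseteq> X}. span F = Y} = {F \<in> range (cell A). span F = Y}"
        by auto
      moreover have "(\<Sum>F\<in>{F \<in> range (cell A). span F = Y}. (-1::int) ^ dim F) =
          (\<Sum>F\<in>{F \<in> range (cell A). span F = Y}. (-1) ^ dim Y)"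
        by (intro sum.cong refl) auto
      ultimately show "(\<Sum>F\<in>{F \<in> {F \<in> range (cell A). span F \<subseteq> X}. span F = Y}. (-1) ^ dim F) = f Y"
        by (simp add: f_def)
    qed
    finally show ?thesis by simp
  qed
  have "f (perp B) = (\<Sum>Y\<in>{Y \<in> ?L. Y \<subseteq> perp B}. moebius ?L (perp B) Y * (-1) ^ dim Y)"
    using B sum_f by (intro moebius_inversion[OF L]) (auto simp: intersection_lattice_eq)
  also have "\<dots> = poly (segment_char_poly ?L (perp B)) (-1)"
    by (simp add: segment_char_poly_def upper_segment_def poly_sum poly_monom)
  finally have "(-1) ^ dim (perp B) * f (perp B) =
      (-1) ^ dim (perp B) * poly (segment_char_poly ?L (perp B)) (-1)"
    by simp
  then show ?thesis
    by (simp only: f_def minus_one_power_mult_cancel)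
qed

subsection \<open>Groups generated by reflections\<close>

lemma reflection_reflection [simp]: "reflection a (reflection a v) = v"
  by (cases "a = 0")
    (simp_all add: reflection_def inner_diff_left scaleR_left_distrib[symmetric] field_simps)

lemma reflection_self: "reflection a a = - a"
  by (cases "a = 0") (simp_all add: reflection_def scaleR_2)

lemma reflection_uminus: "reflection (- a) = reflection a"
  by (simp add: reflection_def fun_eq_iff)

lemma reflection_fixes_iff: "a \<noteq> 0 \<Longrightarrow> reflection a v = v \<longleftrightarrow> inner a v = 0"
  by (simp add: reflection_def inner_commute)

lemma linear_reflection: "linear (reflection a)"
  by (rule linearI)
    (simp_all add: reflection_def inner_add_left algebra_simps add_divide_distrib)

lemma inner_reflection_left: "inner (reflection a u) v = inner u (reflection a v)"
  by (simp add: reflection_def inner_diff_left inner_diff_right inner_commute)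

lemma inner_reflection: "inner (reflection a u) (reflection a v) = inner u v"
  by (simp add: inner_reflection_left)

text \<open>The plain notation \<open>inv\<close> is occupied by the group inverse of \<open>HOL-Algebra\<close>.\<close>

abbreviation invf :: "('a \<Rightarrow> 'b) \<Rightarrow> 'b \<Rightarrow> 'a" where
  "invf \<equiv> inv_into UNIV"

text \<open>Explicit products of reflections, with the rightmost letter acting first, give access to
  induction on the length of an expression.\<close>

primrec word :: "'a::real_inner list \<Rightarrow> 'a \<Rightarrow> 'a" where
  "word [] = id"
| "word (x # xs) = reflection x \<circ> word xs"

lemma word_append: "word (xs @ ys) = word xs \<circ> word ys"
  by (induction xs) (simp_all add: o_assoc)

lemma word_rev_word: "word (rev xs) (word xs v) = v"
  by (induction xs arbitrary: v) (simp_all add: word_append)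

lemma word_word_rev: "word xs (word (rev xs) v) = v"
  using word_rev_word[of "rev xs"] by simp

lemma bij_word: "bij (word xs)"
  by (rule o_bij[of "word (rev xs)"]) (simp_all add: fun_eq_iff word_rev_word word_word_rev)

lemma inv_word: "invf (word xs) = word (rev xs)"
  by (rule inv_equality) (simp_all add: word_rev_word word_word_rev)

lemma linear_word: "linear (word xs)"
  by (induction xs)
    (simp_all add: linear_iff linear_add[OF linear_reflection] linear_scale[OF linear_reflection])

lemma inner_word: "inner (word xs u) (word xs v) = inner u v"
  by (induction xs) (simp_all add: inner_reflection)

section \<open>Reflection groups as sets of words\<close>

abbreviation refls :: "'a::real_inner set \<Rightarrow> ('a \<Rightarrow> 'a) set" where
  "refls S \<equiv> carrier (reflection_group S)"

lemma BijGroup_UNIV_simps: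
  "carrier (BijGroup UNIV) = {f. bij f}"
  "\<one>\<^bsub>BijGroup UNIV\<^esub> = id"
  "bij f \<Longrightarrow> bij g \<Longrightarrow> f \<otimes>\<^bsub>BijGroup UNIV\<^esub> g = f \<circ> g"
  by (auto simp: BijGroup_def Bij_def fun_eq_iff compose_def)

lemma inv_BijGroup_UNIV:
  assumes "bij f"
  shows "inv\<^bsub>BijGroup UNIV\<^esub> f = invf f"
proof -
  interpret group "BijGroup UNIV :: ('a \<Rightarrow> 'a) monoid"
    by (rule group_BijGroup)
  show ?thesis
    using assms
    by (intro inv_equality) (auto simp: BijGroup_UNIV_simps bij_imp_bij_inv inv_o_cancel bij_is_inj)
qed

text \<open>Reflections are involutions, so products of generators already include all
  inverses.\<close>

lemma refls_eq_words: "refls S = {word xs | xs. set xs \<subseteq> S}"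
proof -
  have "refls S = generate (BijGroup UNIV) (carrier (BijGroup UNIV) \<inter> reflection ` S)"
    by (simp add: reflection_group_def carrier_subgroup_generated)
  also have "carrier (BijGroup UNIV) \<inter> reflection ` S = reflection ` S"
    using reflection_in_Bij by auto
  also have "generate (BijGroup UNIV) (reflection ` S) = {word xs | xs. set xs \<subseteq> S}"
  proof (intro equalityI subsetI)
    fix w assume "w \<in> generate (BijGroup UNIV) (reflection ` S)"
    then show "w \<in> {word xs | xs. set xs \<subseteq> S}"
    proof induction
      case one
      show ?case
        by (auto simp: BijGroup_UNIV_simps intro!: exI[of _ "[]"])
    next
      case (incl h)
      then obtain a where "a \<in> S" "h = reflection a" by auto
      then show ?case
        by (auto intro!: exI[of _ "[a]"])
    next
      case (inv h)
      then obtain a where "a \<in> S" "h = word [a]" by auto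
      moreover from this have "inv\<^bsub>BijGroup UNIV\<^esub> h = word [a]"
        using inv_BijGroup_UNIV[OF bij_word[of "[a]"]] inv_word[of "[a]"] by simp
      ultimately show ?case
        by (auto intro!: exI[of _ "[a]"])
    next
      case (eng h1 h2)
      then obtain xs ys where "set xs \<subseteq> S" "set ys \<subseteq> S" "h1 = word xs" "h2 = word ys"
        by auto
      then show ?case
        by (auto simp: BijGroup_UNIV_simps bij_word word_append intro!: exI[of _ "xs @ ys"])
    qed
  next
    fix w assume "w \<in> {word xs | xs. set xs \<subseteq> S}"
    then obtain xs where "w = word xs" "set xs \<subseteq> S" by auto
    moreover have "set xs \<subseteq> S \<Longrightarrow> word xs \<in> generate (BijGroup UNIV) (reflection ` S)" for xs
    proof (induction xs)
      case Nil
      then show ?case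
        using generate.one[of "BijGroup UNIV"] unfolding BijGroup_UNIV_simps word.simps by blast
    next
      case (Cons a xs)
      then have "reflection a \<in> generate (BijGroup UNIV) (reflection ` S)"
        by (auto intro: generate.incl)
      then have "reflection a \<otimes>\<^bsub>BijGroup UNIV\<^esub> word xs \<in> generate (BijGroup UNIV) (reflection ` S)"
        using Cons by (intro generate.eng) auto
      moreover have "bij (reflection a)"
        using bij_word[of "[a]"] by simp
      ultimately show ?case
        by (simp only: BijGroup_UNIV_simps(3) bij_word word.simps)
    qed
    ultimately show "w \<in> generate (BijGroup UNIV) (reflection ` S)" by simp
  qed
  finally show ?thesis .
qed

lemma refls_cases:
  assumes "w \<in> refls S"
  obtains xs where "set xs \<subseteq> S" "w = word xs"
  using assms by (auto simp: refls_eq_words)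

lemma word_in_refls: "set xs \<subseteq> S \<Longrightarrow> word xs \<in> refls S"
  by (auto simp: refls_eq_words)

lemma id_in_refls: "id \<in> refls S"
  using word_in_refls[of "[]"] by simp

lemma reflection_in_refls: "a \<in> S \<Longrightarrow> reflection a \<in> refls S"
  using word_in_refls[of "[a]"] by simp

lemma comp_in_refls: "v \<in> refls S \<Longrightarrow> w \<in> refls S \<Longrightarrow> v \<circ> w \<in> refls S"
  by (elim refls_cases) (simp only: word_append[symmetric] word_in_refls set_append Un_least)

lemma inv_in_refls: "w \<in> refls S \<Longrightarrow> invf w \<in> refls S"
  by (elim refls_cases) (simp only: inv_word word_in_refls set_rev)

lemma refls_mono: "S \<subseteq> T \<Longrightarrow> refls S \<subseteq> refls T"
  by (auto simp: refls_eq_words)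

lemma bij_refls: "w \<in> refls S \<Longrightarrow> bij w"
  by (elim refls_cases) (simp add: bij_word)

lemma inv_apply_refls [simp]:
  assumes "w \<in> refls S"
  shows "invf w (w v) = v" "w (invf w v) = v" "invf w \<circ> w = id" "w \<circ> invf w = id"
  using bij_refls[OF assms]
  by (simp_all add: bij_is_inj bij_is_surj surj_f_inv_f fun_eq_iff)

lemma linear_refls: "w \<in> refls S \<Longrightarrow> linear w"
  by (elim refls_cases) (simp add: linear_word)

lemma inner_refls: "w \<in> refls S \<Longrightarrow> inner (w u) (w v) = inner u v"
  by (elim refls_cases) (simp add: inner_word)

lemma inner_refls_left: "w \<in> refls S \<Longrightarrow> inner (w u) v = inner u (invf w v)"
  using inner_refls[of w S u "invf w v"] by simp

lemma inner_refls_right: "w \<in> refls S \<Longrightarrow> inner u (w v) = inner (invf w u) v"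
  using inner_refls[of w S "invf w u" v] by simp

lemma reflection_image:
  assumes "w \<in> refls S"
  shows "reflection (w a) (w v) = w (reflection a v)"
  using linear_refls[OF assms]
  by (simp add: reflection_def inner_refls[OF assms] linear_diff linear_scale)

lemma mult_reflection_group:
  assumes "v \<in> refls S" "w \<in> refls S"
  shows "v \<otimes>\<^bsub>reflection_group S\<^esub> w = v \<circ> w"
  using assms by (simp add: reflection_group_def subgroup_generated_def
      BijGroup_UNIV_simps bij_refls[unfolded reflection_group_def subgroup_generated_def])

lemma group_reflection_group: "group (reflection_group S)"
  unfolding reflection_group_def
  by (rule group.group_subgroup_generated) (rule group_BijGroup)

lemma one_reflection_group: "\<one>\<^bsub>reflection_group S\<^esub> = id"
  by (simp add: reflection_group_def BijGroup_UNIV_simps)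

lemma inv_reflection_group:
  assumes "w \<in> refls S"
  shows "inv\<^bsub>reflection_group S\<^esub> w = invf w"
  using assms
  by (intro group.inv_equality[OF group_reflection_group])
    (simp_all add: mult_reflection_group inv_in_refls one_reflection_group)

text \<open>Replaces the cosets and group operations in the library notion by composition of
  functions.\<close>

lemma normalizer_reflection_group:
  assumes "H \<subseteq> refls S"
  shows "normalizer (reflection_group S) H = {w \<in> refls S. (\<lambda>h. w \<circ> h \<circ> invf w) ` H = H}"
proof -
  have "w <#\<^bsub>reflection_group S\<^esub> H #>\<^bsub>reflection_group S\<^esub> inv\<^bsub>reflection_group S\<^esub> w =
      (\<lambda>h. w \<circ> h \<circ> invf w) ` H" if w: "w \<in> refls S" for w
  proof -
    have "w \<otimes>\<^bsub>reflection_group S\<^esub> h \<otimes>\<^bsub>reflection_group S\<^esub> invf w = w \<circ> h \<circ> invf w" if "h \<in> H" for h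
      using that w assms by (simp add: mult_reflection_group inv_in_refls comp_in_refls subset_iff)
    then show ?thesis
      by (auto simp: l_coset_def r_coset_def inv_reflection_group[OF w])
  qed
  then show ?thesis
    using assms by (auto simp: normalizer_def stabilizer_def)
qed

subsection \<open>Dual bases\<close>

text \<open>A Gram-Schmidt step: the projection onto the span of \<open>B\<close> is corrected along
  \<open>b - q\<close>, the component of \<open>b\<close> orthogonal to \<open>B\<close>.\<close>

lemma orthogonal_projection_exists:
  fixes B :: "'a::real_inner set"
  assumes "finite B"
  shows "\<exists>p\<in>span B. \<forall>b\<in>B. inner (x - p) b = 0"
  using assms
proof (induction B arbitrary: x rule: finite_induct)
  case empty
  then show ?case by auto
next
  case (insert b B)
  obtain p where p: "p \<in> span B" "\<forall>c\<in>B. inner (x - p) c = 0"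
    using insert.IH by blast
  obtain q where q: "q \<in> span B" "\<forall>c\<in>B. inner (b - q) c = 0"
    using insert.IH by blast
  \<comment> \<open>If \<open>b = q\<close>, division by zero gives \<open>t = 0\<close>, and the
    condition along \<open>b - q\<close> is trivial.\<close>
  define t where "t = inner (x - p) (b - q) / inner (b - q) (b - q)"
  let ?r = "p + t *\<^sub>R (b - q)"
  have perp: "inner (x - ?r) c = 0" if "c \<in> B" for c
    using that p(2) q(2) by (simp add: inner_diff_left inner_add_left)
  have "orthogonal (x - ?r) y" if "y \<in> span B" for y
    by (rule orthogonal_to_span[OF that]) (use perp in \<open>auto simp: orthogonal_def\<close>)
  then have "inner (x - ?r) q = 0"
    using q(1) by (auto simp: orthogonal_def)
  moreover have "inner (x - ?r) (b - q) = 0"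
  proof -
    have "inner (x - ?r) (b - q) = inner (x - p) (b - q) - t * inner (b - q) (b - q)"
      by (simp add: inner_diff_left inner_add_left)
    also have "\<dots> = 0"
      by (cases "b = q") (simp_all add: t_def)
    finally show ?thesis .
  qed
  ultimately have "inner (x - ?r) b = 0"
    by (simp add: inner_diff_right)
  moreover have "?r \<in> span (insert b B)"
    using p(1) q(1) span_mono[of B "insert b B"]
    by (intro span_add span_scale span_diff) (auto intro: span_base)
  ultimately show ?case
    using perp by blast
qed

text \<open>The dual vector of \<open>b\<close> is the component of \<open>b\<close> orthogonal to
  the other members, rescaled; independence makes it nonzero.\<close>

lemma dual_basis_exists:
  fixes B :: "'a::real_inner set"
  assumes "finite B" "independent B"
  shows "\<exists>\<omega>. \<forall>b\<in>B. \<forall>c\<in>B. inner (\<omega> b) c = (if b = c then 1 else 0)"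
proof -
  have "\<exists>z. \<forall>c\<in>B. inner z c = (if b = c then 1 else 0)" if b: "b \<in> B" for b
  proof -
    obtain p where p: "p \<in> span (B - {b})" "\<forall>c\<in>B - {b}. inner (b - p) c = 0"
      using orthogonal_projection_exists[of "B - {b}" b] assms by auto
    have "b \<noteq> p"
      using p(1) b assms(2) by (auto simp: dependent_def)
    have "orthogonal (b - p) p"
      by (rule orthogonal_to_span[OF p(1)]) (use p(2) in \<open>auto simp: orthogonal_def\<close>)
    then have "inner (b - p) b = inner (b - p) (b - p)"
      by (simp add: orthogonal_def inner_diff_right)
    then have "\<forall>c\<in>B. inner ((1 / inner (b - p) (b - p)) *\<^sub>R (b - p)) c = (if b = c then 1 else 0)"
      using p(2) \<open>b \<noteq> p\<close> by auto
    then show ?thesis by blast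
  qed
  then show ?thesis
    by (intro bchoice ballI)
qed

subsection \<open>Positive roots and simple reflections\<close>

locale based_root_system =
  fixes \<Phi> \<Delta> :: "'a::real_inner set"
  assumes root_system: "root_system \<Phi>" and span_roots: "span \<Phi> = UNIV"
    and root_base: "root_base \<Phi> \<Delta>"
begin

lemma finite_roots: "finite \<Phi>"
  and root_nonzero: "\<alpha> \<in> \<Phi> \<Longrightarrow> \<alpha> \<noteq> 0"
  and reflection_root: "\<alpha> \<in> \<Phi> \<Longrightarrow> \<beta> \<in> \<Phi> \<Longrightarrow> reflection \<alpha> \<beta> \<in> \<Phi>"
  using root_system by (auto simp: root_system_def)

lemma root_multiple:
  assumes "\<alpha> \<in> \<Phi>" "c *\<^sub>R \<alpha> \<in> \<Phi>"
  shows "c *\<^sub>R \<alpha> = \<alpha> \<or> c *\<^sub>R \<alpha> = - \<alpha>"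
proof -
  have "c *\<^sub>R \<alpha> \<in> \<Phi> \<inter> range (\<lambda>c. c *\<^sub>R \<alpha>)"
    using assms by blast
  also have "\<dots> = {\<alpha>, - \<alpha>}"
    using root_system assms(1) by (simp add: root_system_def)
  finally show ?thesis by simp
qed

lemma uminus_root: "\<alpha> \<in> \<Phi> \<Longrightarrow> - \<alpha> \<in> \<Phi>"
  using reflection_root[of \<alpha> \<alpha>] by (simp add: reflection_self)

lemma simple_roots: "\<Delta> \<subseteq> \<Phi>" and independent_simple: "independent \<Delta>"
  using root_base by (auto simp: root_base_def)

lemma finite_simple: "finite \<Delta>"
  using finite_subset[OF simple_roots finite_roots] .

lemma span_simple: "span \<Delta> = UNIV"
proof -
  have "\<Phi> \<subseteq> span \<Delta>"
  proof
    fix \<alpha> assume "\<alpha> \<in> \<Phi>"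
    then obtain c where "\<alpha> = (\<Sum>\<beta>\<in>\<Delta>. c \<beta> *\<^sub>R \<beta>)"
      using root_base by (auto simp: root_base_def)
    then show "\<alpha> \<in> span \<Delta>"
      by (simp add: span_sum span_scale span_base)
  qed
  then show ?thesis
    using span_mono[of \<Phi> "span \<Delta>"] span_roots by (auto simp: span_span)
qed

text \<open>The fundamental weights, up to normalisation.\<close>

definition fw :: "'a \<Rightarrow> 'a" where
  "fw = (SOME \<omega>. \<forall>b\<in>\<Delta>. \<forall>c\<in>\<Delta>. inner (\<omega> b) c = (if b = c then 1 else 0))"

lemma inner_fw:
  assumes "\<beta> \<in> \<Delta>" "\<gamma> \<in> \<Delta>"
  shows "inner (fw \<beta>) \<gamma> = (if \<beta> = \<gamma> then 1 else 0)"
  using someI_ex[OF dual_basis_exists[OF finite_simple independent_simple]] assms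
  unfolding fw_def by blast

lemma inner_fw_sum:
  assumes "\<gamma> \<in> \<Delta>"
  shows "inner (fw \<gamma>) (\<Sum>\<beta>\<in>\<Delta>. c \<beta> *\<^sub>R \<beta>) = c \<gamma>"
proof -
  have "inner (fw \<gamma>) (\<Sum>\<beta>\<in>\<Delta>. c \<beta> *\<^sub>R \<beta>) = (\<Sum>\<beta>\<in>\<Delta>. if \<gamma> = \<beta> then c \<beta> else 0)"
    using assms by (auto simp: inner_sum_right inner_fw intro!: sum.cong)
  then show ?thesis
    using assms finite_simple by simp
qed

lemma expand: "(\<Sum>\<beta>\<in>\<Delta>. inner (fw \<beta>) v *\<^sub>R \<beta>) = v"
proof -
  have "v \<in> span \<Delta>"
    by (simp add: span_simple)
  then obtain c where c: "v = (\<Sum>\<beta>\<in>\<Delta>. c \<beta> *\<^sub>R \<beta>)"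
    using span_finite[OF finite_simple] by auto
  then have "inner (fw \<gamma>) v = c \<gamma>" if "\<gamma> \<in> \<Delta>" for \<gamma>
    using inner_fw_sum[OF that] by simp
  then show ?thesis
    using c by simp
qed

lemma inner_expand: "inner u v = (\<Sum>\<beta>\<in>\<Delta>. inner (fw \<beta>) u * inner \<beta> v)"
  by (subst expand[of u, symmetric]) (simp add: inner_sum_left)

lemma eq_if_fw_eq: "(\<And>\<beta>. \<beta> \<in> \<Delta> \<Longrightarrow> inner (fw \<beta>) u = inner (fw \<beta>) v) \<Longrightarrow> u = v"
  using expand[of u] expand[of v] by (metis (mono_tags, lifting) sum.cong)

text \<open>Pairing with \<open>fw \<beta>\<close> reads off the coefficient at
  \<open>\<beta>\<close>, so the roots with this property are the positive roots.\<close>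

definition nonneg :: "'a \<Rightarrow> bool" where
  "nonneg v \<longleftrightarrow> (\<forall>\<beta>\<in>\<Delta>. 0 \<le> inner (fw \<beta>) v)"

text \<open>Membership in the closed fundamental chamber.\<close>

definition dominant :: "'a \<Rightarrow> bool" where
  "dominant v \<longleftrightarrow> (\<forall>\<beta>\<in>\<Delta>. 0 \<le> inner \<beta> v)"

lemma root_cases:
  assumes "\<alpha> \<in> \<Phi>"
  shows "nonneg \<alpha> \<or> nonneg (- \<alpha>)"
proof -
  obtain c where c: "\<alpha> = (\<Sum>\<beta>\<in>\<Delta>. c \<beta> *\<^sub>R \<beta>)"
    "(\<forall>\<beta>\<in>\<Delta>. 0 \<le> c \<beta>) \<or> (\<forall>\<beta>\<in>\<Delta>. c \<beta> \<le> 0)"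
    using assms root_base by (auto simp: root_base_def)
  then have "inner (fw \<beta>) \<alpha> = c \<beta>" if "\<beta> \<in> \<Delta>" for \<beta>
    using that inner_fw_sum by simp
  then show ?thesis
    using c(2) by (auto simp: nonneg_def)
qed

lemma nonneg_antisym: "nonneg v \<Longrightarrow> nonneg (- v) \<Longrightarrow> v = 0"
  by (rule eq_if_fw_eq) (force simp: nonneg_def)

lemma nonneg_simple: "\<beta> \<in> \<Delta> \<Longrightarrow> nonneg \<beta>"
  by (simp add: nonneg_def inner_fw)

lemma inner_nonneg_dominant: "nonneg u \<Longrightarrow> dominant v \<Longrightarrow> 0 \<le> inner u v"
  by (subst inner_expand) (auto simp: nonneg_def dominant_def intro!: sum_nonneg)

lemma fw_simple_reflection:
  "\<beta> \<in> \<Delta> \<Longrightarrow> \<gamma> \<in> \<Delta> \<Longrightarrow> \<gamma> \<noteq> \<beta> \<Longrightarrow> inner (fw \<gamma>) (reflection \<beta> v) = inner (fw \<gamma>) v"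
  by (simp add: reflection_def inner_diff_right inner_fw)

lemma nonneg_multiple_eq:
  assumes "\<alpha> \<in> \<Phi>" "nonneg \<alpha>" "\<beta> \<in> \<Delta>"
    and zero: "\<And>\<gamma>. \<gamma> \<in> \<Delta> \<Longrightarrow> \<gamma> \<noteq> \<beta> \<Longrightarrow> inner (fw \<gamma>) \<alpha> = 0"
  shows "\<alpha> = \<beta>"
proof -
  let ?c = "inner (fw \<beta>) \<alpha>"
  have eq: "\<alpha> = ?c *\<^sub>R \<beta>"
    by (rule eq_if_fw_eq) (use assms in \<open>auto simp: inner_fw\<close>)
  have "- \<beta> \<noteq> \<alpha>"
    using nonneg_antisym[of \<beta>] assms nonneg_simple root_nonzero simple_roots by auto
  then show ?thesis
    using root_multiple[of \<beta> ?c] eq assms simple_roots by auto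
qed

text \<open>The reflection changes only the coefficient at \<open>\<beta>\<close>. If the image were
  negative, all other coefficients of \<open>\<alpha>\<close> would vanish and
  \<open>\<alpha>\<close> would be \<open>\<beta>\<close> itself.\<close>

lemma simple_reflection_nonneg:
  assumes "\<alpha> \<in> \<Phi>" "nonneg \<alpha>" "\<beta> \<in> \<Delta>" "\<alpha> \<noteq> \<beta>"
  shows "nonneg (reflection \<beta> \<alpha>)"
proof (rule ccontr)
  assume "\<not> nonneg (reflection \<beta> \<alpha>)"
  then have neg: "nonneg (- reflection \<beta> \<alpha>)"
    using root_cases reflection_root assms simple_roots by blast
  have "inner (fw \<gamma>) \<alpha> = 0" if "\<gamma> \<in> \<Delta>" "\<gamma> \<noteq> \<beta>" for \<gamma>
    using that neg assms(2,3) fw_simple_reflection[of \<beta> \<gamma> \<alpha>] by (force simp: nonneg_def)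
  then show False
    using nonneg_multiple_eq assms by blast
qed

section \<open>The action on roots, the exchange property and dominant stabilizers\<close>

lemma refls_root:
  assumes "w \<in> refls \<Phi>" "\<alpha> \<in> \<Phi>"
  shows "w \<alpha> \<in> \<Phi>"
proof -
  have "set xs \<subseteq> \<Phi> \<Longrightarrow> word xs \<alpha> \<in> \<Phi>" for xs
    using assms(2) by (induction xs) (auto simp: reflection_root)
  then show ?thesis
    using assms(1) by (auto elim: refls_cases)
qed

lemma word_root: "set xs \<subseteq> \<Delta> \<Longrightarrow> \<alpha> \<in> \<Phi> \<Longrightarrow> word xs \<alpha> \<in> \<Phi>"
  using refls_root word_in_refls simple_roots by (meson subset_trans)

text \<open>Apply the letters to \<open>\<alpha>\<close> from the right. A letter that turns a
  positive root negative must equal that root, so its reflection is the conjugate of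
  \<open>reflection \<alpha>\<close> by the letters to its right, and the two cancel.\<close>

lemma exchange:
  assumes "set xs \<subseteq> \<Delta>" "\<alpha> \<in> \<Phi>" "nonneg \<alpha>" "\<not> nonneg (word xs \<alpha>)"
  shows "\<exists>ys. set ys \<subseteq> \<Delta> \<and> length ys < length xs \<and> word xs \<circ> reflection \<alpha> = word ys"
  using assms
proof (induction xs)
  case Nil
  then show ?case by simp
next
  case (Cons x xs)
  show ?case
  proof (cases "nonneg (word xs \<alpha>)")
    case False
    have "set xs \<subseteq> \<Delta>"
      using Cons.prems by simp
    from Cons.IH[OF this Cons.prems(2,3) False]
    obtain ys where "set ys \<subseteq> \<Delta>" "length ys < length xs" "word xs \<circ> reflection \<alpha> = word ys"
      by blast
    then show ?thesis
      using Cons.prems by (intro exI[of _ "x # ys"]) (auto simp: fun_eq_iff)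
  next
    case True
    have x: "x = word xs \<alpha>"
      using simple_reflection_nonneg[of "word xs \<alpha>" x] True Cons.prems word_root[of xs \<alpha>] by auto
    have "word (x # xs) \<circ> reflection \<alpha> = word xs"
    proof
      fix v
      have "reflection (word xs \<alpha>) (word xs (reflection \<alpha> v)) = word xs (reflection \<alpha> (reflection \<alpha> v))"
        by (rule reflection_image[OF word_in_refls[OF subset_refl]])
      then show "(word (x # xs) \<circ> reflection \<alpha>) v = word xs v"
        by (simp flip: x)
    qed
    then show ?thesis
      using Cons.prems(1) by (intro exI[of _ xs] conjI) (assumption | simp)+
  qed
qed

text \<open>
  If the word makes its last letter \<open>\<beta>\<close> negative, dominance of \<open>v\<close> and of its image forces \<open>\<langle>\<beta>, v\<rangle> = 0\<close>, and
  \<open>\<beta>\<close> can be dropped; otherwise the exchange property yields a shorter word for the same element.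
\<close>

lemma dominant_stabilizer_word:
  assumes "set xs \<subseteq> \<Delta>" "dominant v" "dominant (word xs v)"
  shows "word xs v = v \<and> word xs \<in> refls {\<beta> \<in> \<Delta>. inner \<beta> v = 0}"
  using assms
proof (induction xs rule: length_induct)
  case (1 xs)
  show ?case
  proof (cases xs rule: rev_cases)
    case Nil
    show ?thesis
      unfolding Nil word.simps(1) by (rule conjI[OF id_apply id_in_refls])
  next
    case (snoc ys \<beta>)
    then have \<beta>: "\<beta> \<in> \<Delta>" "set ys \<subseteq> \<Delta>" "length ys < length xs"
      using 1 by auto
    have xs: "word xs = word ys \<circ> reflection \<beta>"
      by (simp add: snoc word_append)
    show ?thesis
    proof (cases "nonneg (word ys \<beta>)")
      case False
      then obtain zs where "set zs \<subseteq> \<Delta>" "length zs < length ys" "word xs = word zs"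
        unfolding xs using exchange[of ys \<beta>] \<beta> simple_roots nonneg_simple by blast
      then show ?thesis
        using 1 \<beta> by auto
    next
      case True
      then have "0 \<le> inner (word ys \<beta>) (word xs v)"
        using 1 inner_nonneg_dominant by blast
      also have "\<dots> = - inner \<beta> v"
        by (simp add: xs inner_word inner_reflection_left[symmetric] reflection_self)
      finally have zero: "inner \<beta> v = 0"
        using 1 \<beta> by (force simp: dominant_def)
      then have fixed: "reflection \<beta> v = v"
        by (simp add: reflection_def inner_commute)
      then have ys: "word ys v = v" "word ys \<in> refls {\<beta> \<in> \<Delta>. inner \<beta> v = 0}"
        using 1 \<beta> xs by auto
      have "word xs v = v"
        using ys(1) fixed by (simp add: xs)
      moreover have "word xs \<in> refls {\<beta> \<in> \<Delta>. inner \<beta> v = 0}"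
        unfolding xs using \<beta> zero by (intro comp_in_refls ys reflection_in_refls) auto
      ultimately show ?thesis ..
    qed
  qed
qed

text \<open>Pairing with this vector is the height, the sum of the simple coefficients. It lies in
  the open fundamental chamber.\<close>

definition rho :: 'a where
  "rho = (\<Sum>\<beta>\<in>\<Delta>. fw \<beta>)"

lemma inner_rho: "inner rho v = (\<Sum>\<beta>\<in>\<Delta>. inner (fw \<beta>) v)"
  by (simp add: rho_def inner_sum_left)

lemma inner_rho_simple: "\<beta> \<in> \<Delta> \<Longrightarrow> inner rho \<beta> = 1"
  by (simp add: inner_rho inner_fw finite_simple)

lemma inner_rho_reflection:
  "\<beta> \<in> \<Delta> \<Longrightarrow> inner rho (reflection \<beta> v) = inner rho v - 2 * inner \<beta> v / inner \<beta> \<beta>"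
  by (simp add: reflection_def inner_diff_right inner_rho_simple inner_commute[of v])

text \<open>A suitable simple reflection takes a positive non-simple root to a positive root of
  smaller height, and the two root reflections are conjugate. Heights are real numbers, so the
  induction counts the roots of smaller height.\<close>

lemma reflection_in_simple:
  assumes "\<alpha> \<in> \<Phi>" "nonneg \<alpha>"
  shows "reflection \<alpha> \<in> refls \<Delta>"
  using assms
proof (induction "card {\<beta> \<in> \<Phi>. inner rho \<beta> < inner rho \<alpha>}" arbitrary: \<alpha> rule: less_induct)
  case less
  show ?case
  proof (cases "\<alpha> \<in> \<Delta>")
    case True
    then show ?thesis by (rule reflection_in_refls)
  next
    case False
    \<comment> \<open>Otherwise expanding one factor of \<open>inner \<alpha> \<alpha>\<close> in
      the base, with nonnegative coefficients, would make it nonpositive.\<close>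
    have "\<exists>\<beta>\<in>\<Delta>. inner \<beta> \<alpha> > 0"
    proof (rule ccontr)
      assume "\<not> (\<exists>\<beta>\<in>\<Delta>. inner \<beta> \<alpha> > 0)"
      then have "inner \<alpha> \<alpha> \<le> 0"
        using less.prems by (subst inner_expand)
          (auto simp: nonneg_def not_less intro!: sum_nonpos mult_nonneg_nonpos)
      then show False
        using less.prems root_nonzero by (metis inner_gt_zero_iff not_less)
    qed
    then obtain \<beta> where \<beta>: "\<beta> \<in> \<Delta>" "inner \<beta> \<alpha> > 0" by auto
    let ?\<gamma> = "reflection \<beta> \<alpha>"
    have \<gamma>: "?\<gamma> \<in> \<Phi>" "nonneg ?\<gamma>"
      using \<beta> less.prems False simple_roots reflection_root simple_reflection_nonneg by blast+
    have "inner \<beta> \<beta> > 0"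
      using \<beta> simple_roots root_nonzero by auto
    then have lt: "inner rho ?\<gamma> < inner rho \<alpha>"
      using \<beta> by (simp add: inner_rho_reflection)
    have "card {\<beta> \<in> \<Phi>. inner rho \<beta> < inner rho ?\<gamma>} < card {\<beta> \<in> \<Phi>. inner rho \<beta> < inner rho \<alpha>}"
      using lt \<gamma> finite_roots by (intro psubset_card_mono psubsetI) auto
    then have IH: "reflection ?\<gamma> \<in> refls \<Delta>"
      using less.hyps \<gamma> by blast
    have s: "reflection \<beta> \<in> refls \<Delta>"
      using \<beta> by (intro reflection_in_refls)
    have "reflection \<alpha> = reflection \<beta> \<circ> reflection ?\<gamma> \<circ> reflection \<beta>"
      using reflection_image[OF s, of \<alpha>] by (auto simp: fun_eq_iff)
    then show ?thesis
      using comp_in_refls[OF comp_in_refls[OF s IH] s] by (simp only:)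
  qed
qed

lemma refls_roots_eq: "refls \<Phi> = refls \<Delta>"
proof
  show "refls \<Delta> \<subseteq> refls \<Phi>"
    by (rule refls_mono[OF simple_roots])
next
  have refl: "reflection \<alpha> \<in> refls \<Delta>" if "\<alpha> \<in> \<Phi>" for \<alpha>
    using reflection_in_simple[of \<alpha>] reflection_in_simple[of "- \<alpha>"] root_cases[OF that]
      uminus_root[OF that] that by (auto simp: reflection_uminus)
  have "set xs \<subseteq> \<Phi> \<Longrightarrow> word xs \<in> refls \<Delta>" for xs
  proof (induction xs)
    case Nil
    then show ?case using id_in_refls by (simp only: word.simps)
  next
    case (Cons x xs)
    then have "reflection x \<circ> word xs \<in> refls \<Delta>"
      using refl by (intro comp_in_refls) auto
    then show ?case by (simp only: word.simps)
  qed
  then show "refls \<Phi> \<subseteq> refls \<Delta>"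
    by (auto elim!: refls_cases)
qed

lemma dominant_stabilizer:
  assumes "w \<in> refls \<Phi>" "dominant v" "dominant (w v)"
  shows "w v = v" "w \<in> refls {\<beta> \<in> \<Delta>. inner \<beta> v = 0}"
proof -
  obtain xs where "set xs \<subseteq> \<Delta>" "w = word xs"
    using assms(1) unfolding refls_roots_eq by (rule refls_cases)
  then show "w v = v" "w \<in> refls {\<beta> \<in> \<Delta>. inner \<beta> v = 0}"
    using dominant_stabilizer_word assms by auto
qed

text \<open>The group acts faithfully on the finite set of roots because the roots span.\<close>

lemma finite_refls: "finite (refls \<Phi>)"
proof -
  have "inj_on (\<lambda>w. restrict w \<Phi>) (refls \<Phi>)"
  proof
    fix v w assume vw: "v \<in> refls \<Phi>" "w \<in> refls \<Phi>" and "restrict v \<Phi> = restrict w \<Phi>"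
    then have "v x = w x" if "x \<in> \<Phi>" for x
      using that by (metis restrict_apply)
    then have "v x = w x" if "x \<in> span \<Phi>" for x
      using linear_eq_on[OF linear_refls[OF vw(1)] linear_refls[OF vw(2)] that] by blast
    then show "v = w"
      by (auto simp: span_roots)
  qed
  moreover have "(\<lambda>w. restrict w \<Phi>) ` refls \<Phi> \<subseteq> \<Phi> \<rightarrow>\<^sub>E \<Phi>"
    using refls_root by auto
  then have "finite ((\<lambda>w. restrict w \<Phi>) ` refls \<Phi>)"
    by (rule finite_subset) (intro finite_PiE finite_roots)
  ultimately show ?thesis
    by (simp add: finite_image_iff)
qed

text \<open>Choose the image of \<open>v\<close> with the largest pairing with \<open>rho\<close>. A
  negative product with some \<open>\<beta>\<close> in \<open>S\<close> would let the reflection in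
  \<open>\<beta>\<close> increase it.\<close>

lemma exists_dominant:
  assumes "S \<subseteq> \<Delta>"
  shows "\<exists>g\<in>refls S. \<forall>\<beta>\<in>S. 0 \<le> inner \<beta> (g v)"
proof -
  have fin: "finite (refls S)"
    using assms simple_roots by (intro finite_subset[OF refls_mono finite_refls]) auto
  obtain g where g: "g \<in> refls S" "\<And>h. h \<in> refls S \<Longrightarrow> inner rho (h v) \<le> inner rho (g v)"
    using ex_is_arg_min_if_finite[OF fin, of "\<lambda>h. - inner rho (h v)"] id_in_refls[of S]
    by (auto simp: is_arg_min_def not_less)
  show ?thesis
  proof (intro bexI[OF _ g(1)] ballI)
    fix \<beta> assume \<beta>: "\<beta> \<in> S"
    then have "inner rho (reflection \<beta> (g v)) \<le> inner rho (g v)"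
      using g(2)[OF comp_in_refls[OF reflection_in_refls[OF \<beta>] g(1)]] by simp
    moreover have "inner \<beta> \<beta> > 0"
      using \<beta> assms simple_roots root_nonzero by auto
    ultimately show "0 \<le> inner \<beta> (g v)"
      using \<beta> assms
      by (auto simp: inner_rho_reflection subset_iff zero_le_divide_iff simp del: inner_gt_zero_iff)
  qed
qed

end

section \<open>Fixed spaces and transport of orthogonal complements\<close>

lemma fixed_space_reflection_group:
  assumes "0 \<notin> K"
  shows "fixed_space (reflection_group K) = perp K"
proof
  show "fixed_space (reflection_group K) \<subseteq> perp K"
  proof
    fix v assume "v \<in> fixed_space (reflection_group K)"
    then have "reflection a v = v" if "a \<in> K" for a
      using reflection_in_refls[OF that] by (simp add: fixed_space_def)
    moreover have "a \<noteq> 0" if "a \<in> K" for a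
      using assms that by blast
    ultimately show "v \<in> perp K"
      unfolding perp_def by (blast dest: reflection_fixes_iff[THEN iffD1])
  qed
next
  have "word xs v = v" if "set xs \<subseteq> K" "v \<in> perp K" for xs v
    using that
  proof (induction xs)
    case (Cons x xs)
    then show ?case
      by (simp add: perp_def reflection_def inner_commute[of v])
  qed simp
  then show "perp K \<subseteq> fixed_space (reflection_group K)"
    by (auto simp: fixed_space_def elim!: refls_cases)
qed

lemma mem_image_refls:
  assumes "w \<in> refls S"
  shows "v \<in> w ` B \<longleftrightarrow> invf w v \<in> B"
proof
  assume "invf w v \<in> B"
  then have "w (invf w v) \<in> w ` B"
    by (rule imageI)
  then show "v \<in> w ` B"
    by (simp only: inv_apply_refls(2)[OF assms])
qed (use assms in auto)

lemma perp_image_refls: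
  assumes "w \<in> refls S"
  shows "perp (w ` A) = w ` perp A"
proof -
  have "v \<in> perp (w ` A) \<longleftrightarrow> invf w v \<in> perp A" for v
    by (simp add: perp_def inner_refls_left[OF assms])
  then show ?thesis
    unfolding set_eq_iff mem_image_refls[OF assms] by blast
qed

context based_root_system
begin

subsection \<open>Faces of the Coxeter arrangement\<close>

text \<open>A representative of the standard face \<open>C\<^sub>J\<close>, the face of the
  fundamental chamber lying on exactly the walls in \<open>J\<close>.\<close>

definition face_point :: "'a set \<Rightarrow> 'a" where
  "face_point J = (\<Sum>\<beta>\<in>\<Delta> - J. fw \<beta>)"

lemma inner_face_point:
  assumes "\<gamma> \<in> \<Delta>"
  shows "inner \<gamma> (face_point J) = (if \<gamma> \<in> J then 0 else 1)"
proof -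
  have "inner \<gamma> (face_point J) = (\<Sum>\<beta>\<in>\<Delta> - J. if \<beta> = \<gamma> then 1 else 0)"
    using assms by (auto simp: face_point_def inner_sum_right inner_fw inner_commute[of \<gamma>] intro!: sum.cong)
  then show ?thesis
    using assms finite_simple by simp
qed

lemma dominant_face_point: "dominant (face_point J)"
  by (simp add: dominant_def inner_face_point)

lemma face_point_zeros: "J \<subseteq> \<Delta> \<Longrightarrow> {\<beta> \<in> \<Delta>. inner \<beta> (face_point J) = 0} = J"
  by (auto simp: inner_face_point split: if_splits)

lemma face_point_perp: "J \<subseteq> \<Delta> \<Longrightarrow> face_point J \<in> perp J"
  by (auto simp: perp_def inner_face_point)

lemma fw_perp: "J \<subseteq> \<Delta> \<Longrightarrow> \<gamma> \<in> \<Delta> - J \<Longrightarrow> fw \<gamma> \<in> perp J"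
  using inner_fw by (auto simp: perp_def inner_commute[of _ "fw \<gamma>"])

text \<open>On a dominant vector a positive root is a sum of nonnegative terms, which vanishes only
  if every term does. Hence the zeros among the simple roots determine the signs of all
  roots.\<close>

lemma dominant_same_cell:
  assumes u: "dominant u" and v: "dominant v"
    and zeros: "\<And>\<beta>. \<beta> \<in> \<Delta> \<Longrightarrow> inner \<beta> u = 0 \<longleftrightarrow> inner \<beta> v = 0"
  shows "u \<in> cell \<Phi> v"
proof -
  have zero: "inner \<alpha> u = 0 \<longleftrightarrow> inner \<alpha> v = 0" if "nonneg \<alpha>" for \<alpha>
  proof -
    have "inner \<alpha> x = 0 \<longleftrightarrow> (\<forall>\<beta>\<in>\<Delta>. inner (fw \<beta>) \<alpha> * inner \<beta> x = 0)" if "dominant x" for x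
      using \<open>nonneg \<alpha>\<close> that unfolding inner_expand[of \<alpha> x]
      by (intro sum_nonneg_eq_0_iff[OF finite_simple]) (simp add: nonneg_def dominant_def)
    then show ?thesis
      using u v zeros by simp
  qed
  have sgn: "sgn (inner \<alpha> u) = sgn (inner \<alpha> v)" if "nonneg \<alpha>" for \<alpha>
    using inner_nonneg_dominant[OF that u] inner_nonneg_dominant[OF that v] zero[OF that]
    by (auto simp: sgn_real_def)
  have "sgn (inner \<alpha> u) = sgn (inner \<alpha> v)" if "\<alpha> \<in> \<Phi>" for \<alpha>
    using root_cases[OF that] sgn[of \<alpha>] sgn[of "- \<alpha>"] by (auto simp: sgn_minus)
  then show ?thesis
    by (simp add: cell_def)
qed

lemma dominant_cell:
  assumes "u \<in> cell \<Phi> v" "dominant v"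
  shows "dominant u"
proof -
  have "0 \<le> inner \<beta> u" if "\<beta> \<in> \<Delta>" for \<beta>
  proof -
    have "sgn (inner \<beta> u) = sgn (inner \<beta> v)" "0 \<le> inner \<beta> v"
      using assms that simple_roots by (auto simp: cell_def dominant_def)
    then show ?thesis
      by (metis sgn_less not_le)
  qed
  then show ?thesis
    by (simp add: dominant_def)
qed

lemma cell_refls:
  assumes "w \<in> refls \<Phi>"
  shows "w u \<in> cell \<Phi> (w v) \<longleftrightarrow> u \<in> cell \<Phi> v"
proof -
  have *: "w u \<in> cell \<Phi> (w v)" if "w \<in> refls \<Phi>" "u \<in> cell \<Phi> v" for w u v
    using that refls_root[OF inv_in_refls[OF that(1)]]
    by (simp add: cell_def inner_refls_right[OF that(1)])
  show ?thesis
    using *[OF assms] *[OF inv_in_refls[OF assms], of "w u" "w v"] assms by auto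
qed

text \<open>A positive root vanishing at \<open>face_point J\<close> has no coefficients outside
  \<open>J\<close>, so it vanishes on all of \<open>perp J\<close>. The flat of the standard face is
  thus cut out by \<open>J\<close> alone.\<close>

lemma perp_face_point_roots:
  assumes "J \<subseteq> \<Delta>"
  shows "perp {\<alpha> \<in> \<Phi>. inner \<alpha> (face_point J) = 0} = perp J"
proof
  have "J \<subseteq> {\<alpha> \<in> \<Phi>. inner \<alpha> (face_point J) = 0}"
    using assms simple_roots by (auto simp: inner_face_point)
  then show "perp {\<alpha> \<in> \<Phi>. inner \<alpha> (face_point J) = 0} \<subseteq> perp J"
    by (rule perp_mono)
next
  have nonneg: "inner \<alpha> v = 0" if "nonneg \<alpha>" "inner \<alpha> (face_point J) = 0" "v \<in> perp J" for \<alpha> v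
  proof -
    have "\<forall>\<beta>\<in>\<Delta>. inner (fw \<beta>) \<alpha> * inner \<beta> (face_point J) = 0"
      using that(2) unfolding inner_expand[of \<alpha> "face_point J"]
      by (subst (asm) sum_nonneg_eq_0_iff[OF finite_simple])
        (use that(1) dominant_face_point in \<open>simp_all add: nonneg_def dominant_def\<close>)
    then have "\<forall>\<beta>\<in>\<Delta> - J. inner (fw \<beta>) \<alpha> = 0"
      by (auto simp: inner_face_point)
    moreover have "\<forall>\<beta>\<in>J. inner \<beta> v = 0"
      using that(3) by (simp add: perp_def)
    ultimately have "\<forall>\<beta>\<in>\<Delta>. inner (fw \<beta>) \<alpha> * inner \<beta> v = 0"
      by auto
    then show ?thesis
      by (subst inner_expand) (simp add: sum.neutral)
  qed
  have "inner \<alpha> v = 0" if "\<alpha> \<in> \<Phi>" "inner \<alpha> (face_point J) = 0" "v \<in> perp J" for \<alpha> v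
    using root_cases[OF that(1)] nonneg[of \<alpha> v] nonneg[of "- \<alpha>" v] that by auto
  then show "perp J \<subseteq> perp {\<alpha> \<in> \<Phi>. inner \<alpha> (face_point J) = 0}"
    by (auto simp: perp_def[of "Collect _"])
qed

lemma span_cell_face_point:
  assumes "J \<subseteq> \<Delta>" "w \<in> refls \<Phi>"
  shows "span (cell \<Phi> (w (face_point J))) = w ` perp J"
proof -
  have "{\<alpha> \<in> \<Phi>. inner \<alpha> (w (face_point J)) = 0} = w ` {\<alpha> \<in> \<Phi>. inner \<alpha> (face_point J) = 0}"
  proof (intro equalityI subsetI)
    fix \<alpha> assume "\<alpha> \<in> {\<alpha> \<in> \<Phi>. inner \<alpha> (w (face_point J)) = 0}"
    then have "invf w \<alpha> \<in> {\<alpha> \<in> \<Phi>. inner \<alpha> (face_point J) = 0}"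
      using assms(2) by (simp add: refls_root inv_in_refls inner_refls_right)
    then show "\<alpha> \<in> w ` {\<alpha> \<in> \<Phi>. inner \<alpha> (face_point J) = 0}"
      using mem_image_refls[OF assms(2)] by blast
  next
    fix \<alpha> assume "\<alpha> \<in> w ` {\<alpha> \<in> \<Phi>. inner \<alpha> (face_point J) = 0}"
    then show "\<alpha> \<in> {\<alpha> \<in> \<Phi>. inner \<alpha> (w (face_point J)) = 0}"
      using assms(2) by (auto simp: refls_root inner_refls)
  qed
  then show ?thesis
    using assms by (simp add: span_cell finite_roots perp_image_refls perp_face_point_roots)
qed

text \<open>Each further simple root lowers the dimension by one, since its dual vector lies in the
  previous flat but not on the new hyperplane.\<close>

lemma dim_perp:
  assumes "K \<subseteq> \<Delta>"
  shows "dim (perp K) = card \<Delta> - card K"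
proof -
  have "finite K"
    using assms finite_simple by (rule finite_subset)
  \<comment> \<open>The additive form keeps truncated subtraction out of the induction.\<close>
  then have "K \<subseteq> \<Delta> \<Longrightarrow> dim (perp K) + card K = card \<Delta>"
  proof (induction K rule: finite_induct)
    case empty
    have "perp {} = (UNIV :: 'a set)"
      by (simp add: perp_def)
    moreover have "dim (UNIV :: 'a set) = card \<Delta>"
      using independent_simple span_simple by (intro dim_eq_card) simp_all
    ultimately show ?case by simp
  next
    case (insert \<beta> K)
    then have "fw \<beta> \<in> perp K" "inner \<beta> (fw \<beta>) \<noteq> 0"
      by (auto simp: fw_perp inner_fw inner_commute[of _ "fw \<beta>"])
    then have "dim (perp K) = Suc (dim (perp (insert \<beta> K)))"
      using dim_slice[OF finite_roots span_roots subspace_perp] by (simp add: perp_insert)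
    then show ?case
      using insert by simp
  qed
  then show ?thesis
    using assms by simp
qed

subsection \<open>Parabolic subgroups\<close>

lemma perp_eq_fixed:
  assumes "J \<subseteq> \<Delta>"
  shows "perp J = {v. \<forall>w\<in>refls J. w v = v}"
proof -
  have "0 \<notin> J"
    using assms simple_roots root_nonzero by blast
  then show ?thesis
    using fixed_space_reflection_group by (auto simp: fixed_space_def)
qed

text \<open>An element fixing \<open>perp J\<close> pointwise fixes the dominant vector
  \<open>face_point J\<close>, whose stabilizer is generated by the simple reflections in
  \<open>J\<close>.\<close>

lemma parabolic_eq_fixator:
  assumes "J \<subseteq> \<Delta>"
  shows "refls J = {w \<in> refls \<Phi>. \<forall>v\<in>perp J. w v = v}"
proof (intro equalityI subsetI)
  have "refls J \<subseteq> refls \<Phi>"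
    using assms simple_roots by (intro refls_mono) auto
  then show "w \<in> {w \<in> refls \<Phi>. \<forall>v\<in>perp J. w v = v}" if "w \<in> refls J" for w
    using that perp_eq_fixed[OF assms] by auto
next
  fix w assume "w \<in> {w \<in> refls \<Phi>. \<forall>v\<in>perp J. w v = v}"
  then have "w \<in> refls \<Phi>" "w (face_point J) = face_point J"
    using face_point_perp[OF assms] by auto
  then show "w \<in> refls J"
    using dominant_stabilizer(2)[of w "face_point J"] dominant_face_point face_point_zeros[OF assms]
    by simp
qed

lemma conjugate_parabolic_mem:
  assumes "J \<subseteq> \<Delta>" "K \<subseteq> \<Delta>" "w \<in> refls \<Phi>" "w ` perp J = perp K" "h \<in> refls J"
  shows "w \<circ> h \<circ> invf w \<in> refls K"
proof -
  have h: "h \<in> refls \<Phi>" "\<forall>v\<in>perp J. h v = v"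
    using assms by (auto simp: parabolic_eq_fixator)
  have "(w \<circ> h \<circ> invf w) v = v" if "v \<in> perp K" for v
    using that assms(3) h(2) unfolding assms(4)[symmetric] by auto
  moreover have "w \<circ> h \<circ> invf w \<in> refls \<Phi>"
    using assms h by (intro comp_in_refls inv_in_refls)
  ultimately show ?thesis
    unfolding parabolic_eq_fixator[OF assms(2)] by blast
qed

lemma invf_invf_refls: "w \<in> refls S \<Longrightarrow> invf (invf w) = w"
  using bij_refls by (rule inv_inv_eq)

lemma invf_image_refls: "w \<in> refls S \<Longrightarrow> w ` A = B \<Longrightarrow> invf w ` B = A"
  by (auto simp: image_image)

text \<open>Makes the orders of the two parabolic subgroups equal, and with \<open>J = K\<close>
  gives one half of the description of the normalizer.\<close>

lemma conjugate_parabolic: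
  assumes "J \<subseteq> \<Delta>" "K \<subseteq> \<Delta>" "w \<in> refls \<Phi>" "w ` perp J = perp K"
  shows "bij_betw (\<lambda>h. w \<circ> h \<circ> invf w) (refls J) (refls K)"
proof (rule bij_betw_byWitness[where f' = "\<lambda>h. invf w \<circ> h \<circ> w"])
  show "(\<lambda>h. w \<circ> h \<circ> invf w) ` refls J \<subseteq> refls K"
    using conjugate_parabolic_mem[OF assms] by blast
  show "(\<lambda>h. invf w \<circ> h \<circ> w) ` refls K \<subseteq> refls J"
    using conjugate_parabolic_mem[OF assms(2,1) inv_in_refls[OF assms(3)]
        invf_image_refls[OF assms(3,4)]] invf_invf_refls[OF assms(3)] by auto
qed (use assms(3) in \<open>auto simp: fun_eq_iff\<close>)

text \<open>A standard parabolic subgroup and its fixed space determine each other, so normalizing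
  the one is the same as preserving the other.\<close>

lemma normalizer_parabolic:
  assumes K: "K \<subseteq> \<Delta>"
  shows "normalizer (reflection_group \<Phi>) (refls K) = {w \<in> refls \<Phi>. w ` perp K = perp K}"
proof -
  have sub: "refls K \<subseteq> refls \<Phi>"
    using K simple_roots by (intro refls_mono) auto
  have "w ` perp K = perp K" if w: "w \<in> refls \<Phi>" and eq: "(\<lambda>h. w \<circ> h \<circ> invf w) ` refls K = refls K" for w
  proof (intro equalityI subsetI)
    fix v assume "v \<in> w ` perp K"
    then obtain u where u: "u \<in> perp K" "v = w u" by auto
    have "g v = v" if "g \<in> refls K" for g
    proof -
      obtain h where h: "h \<in> refls K" "g = w \<circ> h \<circ> invf w"
        using \<open>g \<in> refls K\<close> eq by blast
      then have "h u = u"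
        using u(1) perp_eq_fixed[OF K] by blast
      then show ?thesis
        using u(2) h(2) w by simp
    qed
    then show "v \<in> perp K"
      using perp_eq_fixed[OF K] by blast
  next
    fix v assume v: "v \<in> perp K"
    have "h (invf w v) = invf w v" if "h \<in> refls K" for h
    proof -
      have "w \<circ> h \<circ> invf w \<in> refls K"
        using that eq by blast
      then have "(w \<circ> h \<circ> invf w) v = v"
        using v K perp_eq_fixed by blast
      then show ?thesis
        using w by (metis comp_apply inv_apply_refls(1))
    qed
    then have "invf w v \<in> perp K"
      using perp_eq_fixed[OF K] by blast
    then show "v \<in> w ` perp K"
      using mem_image_refls[OF w] by blast
  qed
  moreover have "(\<lambda>h. w \<circ> h \<circ> invf w) ` refls K = refls K" if "w \<in> refls \<Phi>" "w ` perp K = perp K" for w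
    using conjugate_parabolic[OF K K that] by (rule bij_betw_imp_surj_on)
  ultimately show ?thesis
    unfolding normalizer_reflection_group[OF sub] by blast
qed

section \<open>Similarity of subsets of the base in terms of their fixed spaces\<close>

lemma inner_linear_expand:
  assumes "linear f"
  shows "inner u (f v) = (\<Sum>\<beta>\<in>\<Delta>. inner (fw \<beta>) v * inner u (f \<beta>))"
  by (subst expand[of v, symmetric])
    (simp add: linear_sum[OF assms] linear_scale[OF assms] inner_sum_right)

text \<open>A simple root generates an extremal ray of the cone of nonnegative combinations of \<open>\<Delta>\<close>.\<close>

lemma image_simple_subset:
  assumes JK: "J \<subseteq> \<Delta>" "K \<subseteq> \<Delta>" and g: "g \<in> refls \<Phi>" "g ` perp J = perp K"
    and pos: "\<And>\<gamma>. \<gamma> \<in> J \<Longrightarrow> nonneg (g \<gamma>)" "\<And>\<delta>. \<delta> \<in> K \<Longrightarrow> nonneg (invf g \<delta>)"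
  shows "g ` J \<subseteq> K"
proof
  fix x assume "x \<in> g ` J"
  then obtain \<gamma> where \<gamma>: "\<gamma> \<in> J" "x = g \<gamma>" by auto
  then have x: "x \<in> \<Phi>" "nonneg x"
    using JK simple_roots refls_root[OF g(1)] pos by auto
  \<comment> \<open>For \<open>\<delta>\<close> outside \<open>K\<close> the dual vector lies in
    \<open>perp K\<close>, and \<open>invf g\<close> carries it into \<open>perp J\<close>,
    orthogonal to \<open>\<gamma>\<close>. So \<open>x\<close> is a combination of
    \<open>K\<close>.\<close>
  have supp: "inner (fw \<delta>) x = 0" if "\<delta> \<in> \<Delta> - K" for \<delta>
  proof -
    have "invf g (fw \<delta>) \<in> perp J"
      using fw_perp[OF JK(2) that] invf_image_refls[OF g] by blast
    then show ?thesis
      using \<gamma> inner_refls_right[OF g(1), of "fw \<delta>" \<gamma>] by (simp add: perp_def inner_commute[of _ \<gamma>])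
  qed
  have "\<exists>\<delta>\<in>\<Delta>. inner (fw \<delta>) x \<noteq> 0"
    using eq_if_fw_eq[of x 0] root_nonzero[OF x(1)] by auto
  then obtain \<delta> where \<delta>: "\<delta> \<in> K" "inner (fw \<delta>) x > 0"
    using supp x(2) by (fastforce simp: nonneg_def)
  have lin: "linear (invf g)"
    using linear_refls[OF inv_in_refls[OF g(1)]] .
  \<comment> \<open>Applying \<open>invf g\<close> to the expansion of \<open>x\<close> writes
    \<open>\<gamma>\<close> as a nonnegative combination of positive roots. Its coefficient at
    \<open>\<gamma>'\<close> is zero, so every term is zero there, in particular the one of
    \<open>\<delta>\<close>.\<close>
  have "inner (fw \<gamma>') (invf g \<delta>) = 0" if \<gamma>': "\<gamma>' \<in> \<Delta>" "\<gamma>' \<noteq> \<gamma>" for \<gamma>'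
  proof -
    have "(\<Sum>\<epsilon>\<in>\<Delta>. inner (fw \<epsilon>) x * inner (fw \<gamma>') (invf g \<epsilon>)) = inner (fw \<gamma>') (invf g x)"
      by (rule inner_linear_expand[OF lin, symmetric])
    also have "invf g x = \<gamma>"
      using \<gamma> g(1) by simp
    also have "inner (fw \<gamma>') \<gamma> = 0"
      using \<gamma>' \<gamma> JK inner_fw by auto
    finally have "\<forall>\<epsilon>\<in>\<Delta>. inner (fw \<epsilon>) x * inner (fw \<gamma>') (invf g \<epsilon>) = 0"
    proof (rule sum_nonneg_eq_0_iff[OF finite_simple, THEN iffD1, rotated])
      show "0 \<le> inner (fw \<epsilon>) x * inner (fw \<gamma>') (invf g \<epsilon>)" if "\<epsilon> \<in> \<Delta>" for \<epsilon>
        using that x(2) pos(2) supp \<gamma>'(1) by (cases "\<epsilon> \<in> K") (auto simp: nonneg_def)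
    qed
    then have "inner (fw \<delta>) x * inner (fw \<gamma>') (invf g \<delta>) = 0"
      using \<delta>(1) JK(2) by blast
    then show ?thesis
      using \<delta>(2) by simp
  qed
  then have "invf g \<delta> = \<gamma>"
    using nonneg_multiple_eq[of "invf g \<delta>" \<gamma>] \<delta> \<gamma> JK pos(2) simple_roots
      refls_root[OF inv_in_refls[OF g(1)]] by blast
  then show "x \<in> K"
    using \<gamma> \<delta> inv_apply_refls(2)[OF g(1)] by metis
qed

text \<open>For the converse, \<open>w\<close> is multiplied by an element of
  \<open>W\<^sub>K\<close>, which does not affect the image of \<open>perp J\<close>, until
  positivity holds in both directions and \<open>image_simple_subset\<close> applies twice.\<close>

lemma similar_iff:
  assumes J: "J \<subseteq> \<Delta>" and K: "K \<subseteq> \<Delta>"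
  shows "similar \<Phi> J K \<longleftrightarrow> (\<exists>w\<in>refls \<Phi>. w ` perp J = perp K)"
proof
  assume "similar \<Phi> J K"
  then obtain u where "u \<in> refls \<Phi>" "J = u ` K"
    by (auto simp: similar_def)
  then have "invf u ` perp J = perp K"
    using invf_image_refls perp_image_refls by metis
  then show "\<exists>w\<in>refls \<Phi>. w ` perp J = perp K"
    using \<open>u \<in> refls \<Phi>\<close> inv_in_refls by blast
next
  assume "\<exists>w\<in>refls \<Phi>. w ` perp J = perp K"
  then obtain w where w: "w \<in> refls \<Phi>" "w ` perp J = perp K" by auto
  \<comment> \<open>Dominance of \<open>h (w rho)\<close> with respect to \<open>K\<close> says that
    \<open>rho\<close> pairs nonnegatively with the preimage of each member of \<open>K\<close>
    under \<open>h \<circ> w\<close>.\<close>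
  obtain h where h: "h \<in> refls K" "\<And>\<beta>. \<beta> \<in> K \<Longrightarrow> 0 \<le> inner \<beta> (h (w rho))"
    using exists_dominant[OF K] by blast
  define g where "g = h \<circ> w"
  have h': "h \<in> refls \<Phi>" "\<forall>v\<in>perp K. h v = v"
    using h(1) parabolic_eq_fixator[OF K] by auto
  have g: "g \<in> refls \<Phi>"
    unfolding g_def using h' w by (intro comp_in_refls)
  have "g ` perp J = h ` perp K"
    unfolding g_def w(2)[symmetric] by (simp add: image_comp)
  also have "\<dots> = perp K"
    using h'(2) by auto
  finally have g_perp: "g ` perp J = perp K" .
  \<comment> \<open>Strictness turns the weak inequality for \<open>h (w rho)\<close> into
    positivity of the preimages.\<close>
  have neg_rho: "inner \<alpha> rho < 0" if \<alpha>: "\<alpha> \<in> \<Phi>" "\<not> nonneg \<alpha>" for \<alpha>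
  proof -
    have "nonneg (- \<alpha>)"
      using root_cases that by blast
    then have le: "\<forall>\<beta>\<in>\<Delta>. inner (fw \<beta>) \<alpha> \<le> 0"
      by (simp add: nonneg_def)
    obtain \<beta> where "\<beta> \<in> \<Delta>" "inner (fw \<beta>) \<alpha> < 0"
      using \<alpha>(2) by (auto simp: nonneg_def not_le)
    then have "(\<Sum>\<beta>\<in>\<Delta>. inner (fw \<beta>) \<alpha>) < (\<Sum>\<beta>\<in>\<Delta>. 0)"
      using le finite_simple by (intro sum_strict_mono_ex1) auto
    then show ?thesis
      by (simp add: inner_rho inner_commute[of \<alpha>])
  qed
  have pos_inv: "nonneg (invf g \<delta>)" if "\<delta> \<in> K" for \<delta>
  proof (rule ccontr)
    assume "\<not> nonneg (invf g \<delta>)"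
    then have "inner (invf g \<delta>) rho < 0"
      using neg_rho that K simple_roots refls_root[OF inv_in_refls[OF g]] by blast
    then have "inner \<delta> (g rho) < 0"
      by (simp add: inner_refls_right[OF g])
    then show False
      using h(2)[OF that] by (simp add: g_def)
  qed
  \<comment> \<open>A negative \<open>g \<gamma>\<close> would be a nonpositive combination of
    \<open>K\<close>. Then \<open>\<gamma>\<close> would be one of the positive roots
    \<open>invf g \<epsilon>\<close> with \<open>\<epsilon>\<close> in \<open>K\<close>, although
    its coefficient at \<open>\<gamma>\<close> is 1.\<close>
  have pos: "nonneg (g \<gamma>)" if \<gamma>: "\<gamma> \<in> J" for \<gamma>
  proof (rule ccontr)
    assume "\<not> nonneg (g \<gamma>)"
    then have neg: "nonneg (- g \<gamma>)"
      using root_cases refls_root[OF g] \<gamma> J simple_roots by blast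
    have supp: "inner (fw \<delta>) (g \<gamma>) = 0" if "\<delta> \<in> \<Delta> - K" for \<delta>
    proof -
      have "invf g (fw \<delta>) \<in> perp J"
        using fw_perp[OF K that] invf_image_refls[OF g g_perp] by blast
      then show ?thesis
        using \<gamma> inner_refls_right[OF g, of "fw \<delta>" \<gamma>] by (simp add: perp_def inner_commute[of _ \<gamma>])
    qed
    have lin: "linear (invf g)"
      using linear_refls[OF inv_in_refls[OF g]] .
    have expand_\<gamma>: "inner (fw \<beta>) \<gamma> = (\<Sum>\<epsilon>\<in>\<Delta>. inner (fw \<epsilon>) (g \<gamma>) * inner (fw \<beta>) (invf g \<epsilon>))" for \<beta>
      using inner_linear_expand[OF lin, of "fw \<beta>" "g \<gamma>"] g by simp
    have "inner (fw \<epsilon>) (g \<gamma>) * inner (fw \<beta>) (invf g \<epsilon>) \<le> 0" if "\<epsilon> \<in> \<Delta>" "\<beta> \<in> \<Delta>" for \<epsilon> \<beta>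
      using that neg supp pos_inv by (cases "\<epsilon> \<in> K") (auto simp: nonneg_def mult_nonpos_nonneg)
    then have "inner (fw \<gamma>) \<gamma> \<le> 0"
      using \<gamma> J unfolding expand_\<gamma>[of \<gamma>] by (intro sum_nonpos) auto
    then show False
      using \<gamma> J inner_fw[of \<gamma> \<gamma>] by auto
  qed
  have "g ` J \<subseteq> K"
    using image_simple_subset[OF J K g g_perp] pos pos_inv by blast
  moreover have "invf g ` K \<subseteq> J"
    using image_simple_subset[OF K J inv_in_refls[OF g] invf_image_refls[OF g g_perp]] pos pos_inv
    unfolding invf_invf_refls[OF g] by blast
  ultimately have "J = invf g ` K"
    using g by (metis image_mono invf_image_refls subset_antisym)
  then show "similar \<Phi> J K"
    using inv_in_refls[OF g] by (auto simp: similar_def)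
qed

subsection \<open>Counting faces\<close>

text \<open>Move \<open>v\<close> into the fundamental chamber and let \<open>J\<close> consist of
  the walls containing the image.\<close>

lemma exists_face_point:
  "\<exists>w\<in>refls \<Phi>. \<exists>J\<subseteq>\<Delta>. cell \<Phi> v = cell \<Phi> (w (face_point J))"
proof -
  obtain g where g: "g \<in> refls \<Delta>" "dominant (g v)"
    using exists_dominant[OF subset_refl] by (auto simp: dominant_def)
  let ?J = "{\<beta> \<in> \<Delta>. inner \<beta> (g v) = 0}"
  have g': "g \<in> refls \<Phi>"
    using g by (simp add: refls_roots_eq)
  have "g v \<in> cell \<Phi> (face_point ?J)"
    by (rule dominant_same_cell[OF g(2) dominant_face_point]) (simp add: inner_face_point)
  then have "v \<in> cell \<Phi> (invf g (face_point ?J))"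
    using cell_refls[OF g', of v "invf g (face_point ?J)"] g' by simp
  then show ?thesis
    using inv_in_refls[OF g'] by (intro bexI[of _ "invf g"] exI[of _ ?J]) (auto simp: cell_eq)
qed

text \<open>If the cells agree, the relative element \<open>invf w \<circ> w'\<close> takes a
  dominant vector to a dominant one and so fixes it. The stabilizer gives the coset, and the
  vanishing simple roots give \<open>J' = J\<close>.\<close>

lemma cell_face_point_eq_iff:
  assumes J: "J \<subseteq> \<Delta>" "J' \<subseteq> \<Delta>" and w: "w \<in> refls \<Phi>" "w' \<in> refls \<Phi>"
  shows "cell \<Phi> (w' (face_point J')) = cell \<Phi> (w (face_point J)) \<longleftrightarrow>
    J' = J \<and> invf w \<circ> w' \<in> refls J"
proof
  assume eq: "cell \<Phi> (w' (face_point J')) = cell \<Phi> (w (face_point J))"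
  let ?u = "invf w \<circ> w'"
  have u: "?u \<in> refls \<Phi>"
    using w by (intro comp_in_refls inv_in_refls)
  have "w (?u (face_point J')) \<in> cell \<Phi> (w (face_point J))"
    using eq mem_cell_self[of "w' (face_point J')" \<Phi>] w(1) by simp
  then have cell: "?u (face_point J') \<in> cell \<Phi> (face_point J)"
    by (simp only: cell_refls[OF w(1)])
  then have "dominant (?u (face_point J'))"
    by (rule dominant_cell) (rule dominant_face_point)
  from dominant_stabilizer[OF u dominant_face_point this]
  have *: "?u (face_point J') = face_point J'" "?u \<in> refls J'"
    unfolding face_point_zeros[OF J(2)] .
  have "inner \<beta> (face_point J') = 0 \<longleftrightarrow> inner \<beta> (face_point J) = 0" if "\<beta> \<in> \<Delta>" for \<beta>
    using cell_zero[OF cell[unfolded *(1)]] that simple_roots by blast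
  then have "J' = J"
    using face_point_zeros[OF J(1)] face_point_zeros[OF J(2)] by blast
  then show "J' = J \<and> ?u \<in> refls J"
    using *(2) by blast
next
  assume *: "J' = J \<and> invf w \<circ> w' \<in> refls J"
  then have "(invf w \<circ> w') (face_point J) = face_point J"
    using perp_eq_fixed[OF J(1)] face_point_perp[OF J(1)] by blast
  then have "w' (face_point J) = w (face_point J)"
    using w(1) by (metis comp_apply inv_apply_refls(2))
  then show "cell \<Phi> (w' (face_point J')) = cell \<Phi> (w (face_point J))"
    using * by simp
qed

theorem card_similarity_class:
  assumes K: "K \<subseteq> \<Delta>"
  shows "card (similarity_class \<Phi> \<Delta> K) * card (normalizer (reflection_group \<Phi>) (refls K)) =
    card (refls K) * card {F \<in> range (cell \<Phi>). span F = perp K}"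
proof -
  let ?R = "{F \<in> range (cell \<Phi>). span F = perp K}"
  let ?N = "{w \<in> refls \<Phi>. w ` perp K = perp K}"
  define T where "T J = {w \<in> refls \<Phi>. w ` perp J = perp K}" for J
  \<comment> \<open>Both counts concern these pairs: projecting to \<open>J\<close> gives fibres of
    the size of the normalizer, and mapping to the face by \<open>f\<close> gives fibres of the size
    of \<open>W\<^sub>K\<close>.\<close>
  define P where "P = (SIGMA J:similarity_class \<Phi> \<Delta> K. T J)"
  define f where "f = (\<lambda>(J, w). cell \<Phi> (w (face_point J)))"
  have finT: "finite (T J)" for J
    unfolding T_def using finite_refls by simp
  have finS: "finite (similarity_class \<Phi> \<Delta> K)"
    using finite_simple by (auto simp: similarity_class_def)
  have finP: "finite P"
    unfolding P_def using finS finT by (intro finite_SigmaI)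
  have finR: "finite ?R"
    using finite_range_cell[OF finite_roots] by simp
  have P_iff: "(J, w) \<in> P \<longleftrightarrow> J \<subseteq> \<Delta> \<and> w \<in> refls \<Phi> \<and> w ` perp J = perp K" for J w
    using similar_iff[OF _ K] by (auto simp: P_def T_def similarity_class_def)
  have card_T: "card (T J) = card ?N" if "J \<in> similarity_class \<Phi> \<Delta> K" for J
  proof -
    have "J \<subseteq> \<Delta>" "similar \<Phi> J K"
      using that by (auto simp: similarity_class_def)
    then obtain u where u: "u \<in> refls \<Phi>" "u ` perp J = perp K"
      using similar_iff[OF _ K] by blast
    \<comment> \<open>One element \<open>u\<close> taking \<open>perp J\<close> to
      \<open>perp K\<close> identifies all such elements with the stabilizer of
      \<open>perp K\<close> by right translation.\<close>
    have "bij_betw (\<lambda>w. w \<circ> u) ?N (T J)"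
    proof (rule bij_betw_byWitness[where f' = "\<lambda>w. w \<circ> invf u"])
      show "\<forall>w\<in>?N. w \<circ> u \<circ> invf u = w" "\<forall>w\<in>T J. w \<circ> invf u \<circ> u = w"
        using u(1) by (simp_all add: comp_assoc)
      show "(\<lambda>w. w \<circ> u) ` ?N \<subseteq> T J"
      proof (rule image_subsetI)
        fix w assume w: "w \<in> ?N"
        then have "w \<circ> u \<in> refls \<Phi>"
          using u(1) comp_in_refls by blast
        moreover have "(w \<circ> u) ` perp J = perp K"
          using w u(2) by (simp only: image_comp[symmetric] mem_Collect_eq)
        ultimately show "w \<circ> u \<in> T J"
          unfolding T_def by blast
      qed
      show "(\<lambda>w. w \<circ> invf u) ` T J \<subseteq> ?N"
      proof (rule image_subsetI)
        fix w assume w: "w \<in> T J"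
        then have "w \<circ> invf u \<in> refls \<Phi>"
          unfolding T_def using u(1) comp_in_refls inv_in_refls by blast
        moreover have "(w \<circ> invf u) ` perp K = perp K"
          using w invf_image_refls[OF u] by (simp only: T_def image_comp[symmetric] mem_Collect_eq)
        ultimately show "w \<circ> invf u \<in> ?N"
          by blast
      qed
    qed
    then show ?thesis
      by (rule bij_betw_same_card[symmetric])
  qed
  have card_fibre: "card {p \<in> P. f p = F} = card (refls K)" if F: "F \<in> ?R" for F
  proof -
    obtain v where v: "F = cell \<Phi> v" "span F = perp K"
      using F by auto
    obtain w J where wJ: "w \<in> refls \<Phi>" "J \<subseteq> \<Delta>" "F = cell \<Phi> (w (face_point J))"
      using exists_face_point[of v] v(1) by auto
    have w_perp: "w ` perp J = perp K"
      using span_cell_face_point[OF wJ(2,1)] v(2) wJ(3) by simp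
    have J_sub: "refls J \<subseteq> refls \<Phi>"
      using wJ(2) simple_roots by (intro refls_mono) auto
    \<comment> \<open>The face determines \<open>J\<close>, and the second components run through
      the coset \<open>w W\<^sub>J\<close>.\<close>
    have fibre_iff: "p \<in> {p \<in> P. f p = F} \<longleftrightarrow> (\<exists>w'\<in>refls \<Phi>. p = (J, w') \<and> invf w \<circ> w' \<in> refls J)" for p
    proof -
      obtain J' w' where p: "p = (J', w')" by force
      show ?thesis
      proof
        assume "p \<in> {p \<in> P. f p = F}"
        then have "J' \<subseteq> \<Delta>" "w' \<in> refls \<Phi>" "cell \<Phi> (w' (face_point J')) = cell \<Phi> (w (face_point J))"
          using P_iff wJ(3) by (auto simp: p f_def)
        then show "\<exists>w'\<in>refls \<Phi>. p = (J, w') \<and> invf w \<circ> w' \<in> refls J"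
          using cell_face_point_eq_iff[OF wJ(2) _ wJ(1)] p by blast
      next
        assume "\<exists>w'\<in>refls \<Phi>. p = (J, w') \<and> invf w \<circ> w' \<in> refls J"
        then have *: "w' \<in> refls \<Phi>" "J' = J" "invf w \<circ> w' \<in> refls J"
          using p by auto
        then have eq: "cell \<Phi> (w' (face_point J)) = F"
          using cell_face_point_eq_iff[OF wJ(2,2,1)] wJ(3) by blast
        then have "w' ` perp J = perp K"
          using span_cell_face_point[OF wJ(2) *(1)] v(2) by simp
        then show "p \<in> {p \<in> P. f p = F}"
          using eq * wJ(2) P_iff by (auto simp: p f_def)
      qed
    qed
    have "bij_betw (\<lambda>u. (J, w \<circ> u)) (refls J) {p \<in> P. f p = F}"
    proof (rule bij_betw_byWitness[where f' = "\<lambda>p. invf w \<circ> snd p"])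
      have cancel: "invf w \<circ> (w \<circ> u) = u" "w \<circ> (invf w \<circ> u) = u" for u
        using wJ(1) by (simp_all add: comp_assoc[symmetric])
      show "\<forall>u\<in>refls J. invf w \<circ> snd (J, w \<circ> u) = u"
        by (simp add: cancel del: o_apply)
      show "\<forall>p\<in>{p \<in> P. f p = F}. (J, w \<circ> (invf w \<circ> snd p)) = p"
        unfolding cancel using fibre_iff by fastforce
      show "(\<lambda>u. (J, w \<circ> u)) ` refls J \<subseteq> {p \<in> P. f p = F}"
      proof (rule image_subsetI)
        fix u assume u: "u \<in> refls J"
        have "w \<circ> u \<in> refls \<Phi>"
          using wJ(1) u J_sub by (intro comp_in_refls) auto
        then show "(J, w \<circ> u) \<in> {p \<in> P. f p = F}"
          unfolding fibre_iff using u cancel(1)[of u] by (intro bexI[of _ "w \<circ> u"]) (simp_all only: simp_thms)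
      qed
      show "(\<lambda>p. invf w \<circ> snd p) ` {p \<in> P. f p = F} \<subseteq> refls J"
        using fibre_iff by fastforce
    qed
    then have "card {p \<in> P. f p = F} = card (refls J)"
      by (rule bij_betw_same_card[symmetric])
    also have "\<dots> = card (refls K)"
      using conjugate_parabolic[OF wJ(2) K wJ(1) w_perp] by (rule bij_betw_same_card)
    finally show ?thesis .
  qed
  have "f ` P \<subseteq> ?R"
    using P_iff span_cell_face_point by (auto simp: f_def)
  then have "card P = (\<Sum>F\<in>?R. card {p \<in> P. f p = F})"
    using sum.group[OF finP finR, of f "\<lambda>_. 1::nat"] by simp
  also have "\<dots> = card (refls K) * card ?R"
    using card_fibre by simp
  finally have "card P = card (refls K) * card ?R" .
  moreover have "card P = card (similarity_class \<Phi> \<Delta> K) * card ?N"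
    unfolding P_def using finS finT card_T by (simp add: card_SigmaI)
  ultimately show ?thesis
    by (simp add: normalizer_parabolic[OF K])
qed

end

section \<open>Combining the two counts of faces with span \<open>perp K\<close>\<close>

theorem theorem1:
  fixes \<Phi> \<Delta> K :: "'a::real_inner set" and n :: nat
  assumes "root_system \<Phi>" and "span \<Phi> = UNIV"
    and "root_base \<Phi> \<Delta>" and "card \<Delta> = n"
    and "K \<subseteq> \<Delta>"
  shows "real (card (similarity_class \<Phi> \<Delta> K)) =
    (-1) ^ (n - card K)
    * (real (order (reflection_group K))
        / real (card (normalizer (reflection_group \<Phi>) (carrier (reflection_group K)))))
    * real_of_int (poly (segment_char_poly (intersection_lattice \<Phi>)
                           (fixed_space (reflection_group K))) (-1))"
proof -
  interpret based_root_system \<Phi> \<Delta>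
    using assms by unfold_locales
  let ?N = "card (normalizer (reflection_group \<Phi>) (refls K))"
  let ?\<chi> = "poly (segment_char_poly (intersection_lattice \<Phi>) (perp K)) (-1)"
  let ?r = "card {F \<in> range (cell \<Phi>). span F = perp K}"
  have K: "K \<subseteq> \<Phi>" "0 \<notin> K"
    using assms(5) simple_roots root_nonzero by auto
  \<comment> \<open>The normalizer is finite and contains the identity, so its order can be divided
    out.\<close>
  have "id \<in> normalizer (reflection_group \<Phi>) (refls K)"
    unfolding normalizer_parabolic[OF assms(5)] using id_in_refls by auto
  moreover have "finite (normalizer (reflection_group \<Phi>) (refls K))"
    unfolding normalizer_parabolic[OF assms(5)] using finite_refls by simp
  ultimately have "?N \<noteq> 0"
    by auto
  have "real (card (similarity_class \<Phi> \<Delta> K)) * real ?N = real (card (refls K)) * real ?r"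
    by (simp only: of_nat_mult[symmetric] card_similarity_class[OF assms(5)])
  also have "real ?r = real_of_int (int ?r)"
    by simp
  also have "\<dots> = (-1) ^ (n - card K) * real_of_int ?\<chi>"
    unfolding zaslavsky[OF finite_roots span_roots K(1)] dim_perp[OF assms(5)] assms(4) by simp
  finally have "real (card (similarity_class \<Phi> \<Delta> K)) * real ?N =
    real (card (refls K)) * ((-1) ^ (n - card K) * real_of_int ?\<chi>)" .
  then show ?thesis
    using \<open>?N \<noteq> 0\<close> by (simp add: order_def fixed_space_reflection_group[OF K(2)] field_simps)
qed

end
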